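(* $$a_2(K[S])\le\left\lfloor\frac{F_1+F_2}{d}\right\rfloor.$$
   Context: Let $K$ be a field, $k\ge 3$, and let $0=:a_0<a_1<\cdots<a_k=:d$ be integers with $\gcd(a_1,\dots,a_k)=1$ and $k<d$. Put $A_1=\{0,a_1,\dots,a_k\}$, $A_2=\{d-a_i\mid 0\le i\le k\}$. For $i\in\{1,2\}$, $F_i$ is the Frobenius number of $A_i\setminus\{0\}$, i.e. the greatest integer not belonging to the submonoid $\langle A_i\rangle$ of $\mathbb N$ generated by $A_i$ (so $F_i=-1$ if $1\in A_i$). Let $S\subset\mathbb N^2$ be the additive monoid generated by $(a_i,d-a_i)$, $0\le i\le k$, and $K[S]$ its semigroup ring (isomorphic to $K[s^{a_i}t^{d-a_i}\mid 0\le i\le k]$), graded by $\deg(u_1,u_2)=(u_1+u_2)/d$, with maximal homogeneous ideal $\mathfrak m$. $a_2(K[S])=\sup\{n\mid H^2_{\mathfrak m}(K[S])_n\ne0\}$, where $H^2_{\mathfrak m}$ is local cohomology (not to be confused with the integer $a_2$). *)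

theory Defs
  imports
    "HOL-Algebra.Ideal_Product"
    "HOL-Algebra.Module"
    "HOL-Library.Poly_Mapping"
    "HOL-Library.Product_Plus"
    "HOL-Library.Extended_Real"
begin

inductive_set submonoid_gen :: "'a::comm_monoid_add set \<Rightarrow> 'a set" for A where
  zero: "0 \<in> submonoid_gen A"
| add: "x \<in> submonoid_gen A \<Longrightarrow> y \<in> A \<Longrightarrow> x + y \<in> submonoid_gen A"

text \<open>The maximum is taken over the integers, so that the value is \<open>-1\<close> when \<open>1 \<in> A\<close>.  Whether or
  not \<open>0 \<in> A\<close> is irrelevant.  The maximum exists when \<open>Gcd A = 1\<close>.\<close>

definition frobenius_number :: "nat set \<Rightarrow> int" where
  "frobenius_number A = (GREATEST z::int. z \<notin> int ` submonoid_gen A)"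


section \<open>Graded rings and graded modules\<close>

text \<open>Rings and modules over them, together with the family of their homogeneous components.\<close>

record 'a gring = "'a ring" +
  rcomp :: "int \<Rightarrow> 'a set"

record ('a, 'b) gmodule = "('a, 'b) module" +
  mcomp :: "int \<Rightarrow> 'b set"

text \<open>The last clause says that \<open>M\<close> is the (internal) direct sum of its components.\<close>

definition graded_module :: "'a gring \<Rightarrow> ('a, 'b) gmodule \<Rightarrow> bool" where
  "graded_module R M \<longleftrightarrow>
     Module.module R M \<and>
     (\<forall>n. additive_subgroup (mcomp M n) M) \<and>
     (\<forall>i j. \<forall>r\<in>rcomp R i. \<forall>x\<in>mcomp M j. r \<odot>\<^bsub>M\<^esub> x \<in> mcomp M (i + j)) \<and>
     (\<forall>x\<in>carrier M. \<exists>!c. (\<forall>n. c n \<in> mcomp M n) \<and> finite {n. c n \<noteq> \<zero>\<^bsub>M\<^esub>} \<and>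
        x = (\<Oplus>\<^bsub>M\<^esub>n\<in>{n. c n \<noteq> \<zero>\<^bsub>M\<^esub>}. c n))"

definition regular_gmodule :: "'a gring \<Rightarrow> ('a, 'a) gmodule" where
  "regular_gmodule R =
     \<lparr>carrier = carrier R, monoid.mult = monoid.mult R, one = \<one>\<^bsub>R\<^esub>, zero = \<zero>\<^bsub>R\<^esub>, add = add R,
      smult = monoid.mult R, mcomp = rcomp R\<rparr>"

definition graded_hom ::
  "'a gring \<Rightarrow> ('a, 'b) gmodule \<Rightarrow> ('a, 'c) gmodule \<Rightarrow> ('b \<Rightarrow> 'c) \<Rightarrow> bool" where
  "graded_hom R M N f \<longleftrightarrow>
     f \<in> carrier M \<rightarrow> carrier N \<and>
     (\<forall>x\<in>carrier M. \<forall>y\<in>carrier M. f (x \<oplus>\<^bsub>M\<^esub> y) = f x \<oplus>\<^bsub>N\<^esub> f y) \<and>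
     (\<forall>r\<in>carrier R. \<forall>x\<in>carrier M. f (r \<odot>\<^bsub>M\<^esub> x) = r \<odot>\<^bsub>N\<^esub> f x) \<and>
     (\<forall>n. f ` mcomp M n \<subseteq> mcomp N n)"

text \<open>The ideal generated by the homogeneous elements of positive degree; it is the maximal
  homogeneous ideal if the components of negative degree vanish and the one of degree \<open>0\<close> is a
  field.\<close>

definition irrelevant_ideal :: "'a gring \<Rightarrow> 'a set" where
  "irrelevant_ideal R = genideal R (\<Union>n\<in>{1..}. rcomp R n)"


section \<open>Graded local cohomology\<close>

text \<open>Injective objects of the category of graded modules and homomorphisms of degree \<open>0\<close>.  A
  definition cannot quantify over types, so the modules \<open>M\<close> and \<open>N\<close> of the extension problem live
  on the type of the ring elements.  By (the graded version of) Baer's criterion this is no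
  restriction: the inclusions of the homogeneous ideals of \<open>R\<close> into \<open>R\<close>, with arbitrarily
  shifted gradings, are among these extension problems, whatever the type \<open>'b\<close> is.\<close>

definition graded_injective :: "'a gring \<Rightarrow> ('a, 'b) gmodule \<Rightarrow> bool" where
  "graded_injective R E \<longleftrightarrow>
     graded_module R E \<and>
     (\<forall>(M :: ('a, 'a) gmodule) (N :: ('a, 'a) gmodule) j f.
        graded_module R M \<longrightarrow> graded_module R N \<longrightarrow>
        graded_hom R M N j \<longrightarrow> inj_on j (carrier M) \<longrightarrow> graded_hom R M E f \<longrightarrow>
        (\<exists>g. graded_hom R N E g \<and> (\<forall>x\<in>carrier M. g (j x) = f x)))"

text \<open>Exactness of \<open>0 \<rightarrow> M \<rightarrow> E 0 \<rightarrow> E 1 \<rightarrow> E 2 \<rightarrow> \<dots>\<close> with augmentation \<open>\<epsilon>\<close>, differentials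
  \<open>\<delta> i : E i \<rightarrow> E (i + 1)\<close> and injective graded modules \<open>E i\<close>.\<close>

definition graded_injective_resolution ::
  "'a gring \<Rightarrow> ('a, 'c) gmodule \<Rightarrow> (nat \<Rightarrow> ('a, 'b) gmodule) \<Rightarrow> ('c \<Rightarrow> 'b) \<Rightarrow> (nat \<Rightarrow> 'b \<Rightarrow> 'b) \<Rightarrow> bool"
where
  "graded_injective_resolution R M E \<epsilon> \<delta> \<longleftrightarrow>
     graded_module R M \<and>
     (\<forall>i. graded_injective R (E i)) \<and>
     graded_hom R M (E 0) \<epsilon> \<and>
     (\<forall>i. graded_hom R (E i) (E (Suc i)) (\<delta> i)) \<and>
     inj_on \<epsilon> (carrier M) \<and>
     \<epsilon> ` carrier M = {x \<in> carrier (E 0). \<delta> 0 x = \<zero>\<^bsub>E 1\<^esub>} \<and>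
     (\<forall>i. \<delta> i ` carrier (E i) = {x \<in> carrier (E (Suc i)). \<delta> (Suc i) x = \<zero>\<^bsub>E (Suc (Suc i))\<^esub>})"

text \<open>The functor \<open>\<Gamma>\<^sub>I\<close>: elements annihilated by some power of the ideal \<open>I\<close>.\<close>

definition torsion :: "'a gring \<Rightarrow> 'a set \<Rightarrow> ('a, 'b) gmodule \<Rightarrow> 'b set" where
  "torsion R I M =
     {x \<in> carrier M. \<exists>t::nat. \<forall>r \<in> I [^]\<^bsub>ideals_set R\<^esub> t. r \<odot>\<^bsub>M\<^esub> x = \<zero>\<^bsub>M\<^esub>}"

text \<open>Cocycles and coboundaries of degree \<open>n\<close> at position \<open>i\<close> of the complex \<open>\<Gamma>\<^sub>I(E)\<close>.\<close>

definition lc_cocycles ::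
  "'a gring \<Rightarrow> 'a set \<Rightarrow> (nat \<Rightarrow> ('a, 'b) gmodule) \<Rightarrow> (nat \<Rightarrow> 'b \<Rightarrow> 'b) \<Rightarrow> nat \<Rightarrow> int \<Rightarrow> 'b set" where
  "lc_cocycles R I E \<delta> i n =
     {x \<in> torsion R I (E i) \<inter> mcomp (E i) n. \<delta> i x = \<zero>\<^bsub>E (Suc i)\<^esub>}"

definition lc_coboundaries ::
  "'a gring \<Rightarrow> 'a set \<Rightarrow> (nat \<Rightarrow> ('a, 'b) gmodule) \<Rightarrow> (nat \<Rightarrow> 'b \<Rightarrow> 'b) \<Rightarrow> nat \<Rightarrow> int \<Rightarrow> 'b set" where
  "lc_coboundaries R I E \<delta> i n =
     (case i of 0 \<Rightarrow> {\<zero>\<^bsub>E 0\<^esub>} | Suc j \<Rightarrow> \<delta> j ` (torsion R I (E j) \<inter> mcomp (E j) n))"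

text \<open>If \<open>(E, \<delta>)\<close> is a graded injective resolution of \<open>M\<close>, this is the additive group
  \<open>H\<^sup>i\<^sub>I(M)\<^sub>n\<close>; up to isomorphism it does not depend on the resolution.\<close>

definition local_cohomology ::
  "'a gring \<Rightarrow> 'a set \<Rightarrow> (nat \<Rightarrow> ('a, 'b) gmodule) \<Rightarrow> (nat \<Rightarrow> 'b \<Rightarrow> 'b) \<Rightarrow> nat \<Rightarrow> int \<Rightarrow> 'b set monoid"
where
  "local_cohomology R I E \<delta> i n =
     (add_monoid (E i)) \<lparr>carrier := lc_cocycles R I E \<delta> i n\<rparr> Mod lc_coboundaries R I E \<delta> i n"

text \<open>The supremum is taken in the extended reals, so that it is \<open>-\<infinity>\<close> if \<open>H\<^sup>i\<^sub>I(M) = 0\<close>.\<close>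

definition a_invariant ::
  "'a gring \<Rightarrow> 'a set \<Rightarrow> (nat \<Rightarrow> ('a, 'b) gmodule) \<Rightarrow> (nat \<Rightarrow> 'b \<Rightarrow> 'b) \<Rightarrow> nat \<Rightarrow> ereal" where
  "a_invariant R I E \<delta> i =
     (SUP n \<in> {n::int. carrier (local_cohomology R I E \<delta> i n) \<noteq> {\<one>\<^bsub>local_cohomology R I E \<delta> i n\<^esub>}}.
        ereal (real_of_int n))"


section \<open>The monoid and its semigroup ring\<close>

definition curve_monoid :: "nat \<Rightarrow> (nat \<Rightarrow> nat) \<Rightarrow> (nat \<times> nat) set" where
  "curve_monoid k a = submonoid_gen ((\<lambda>i. (a i, a k - a i)) ` {0..k})"

text \<open>Finitely supported functions with the convolution product form the monoid algebra of
  \<open>\<nat>\<^sup>2\<close>; those supported on the submonoid \<open>S\<close> form \<open>K[S]\<close>.  The monomial with exponent \<open>u\<close> has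
  degree \<open>(fst u + snd u) / d\<close>.\<close>

definition semigroup_ring :: "nat \<Rightarrow> (nat \<times> nat) set \<Rightarrow> ((nat \<times> nat) \<Rightarrow>\<^sub>0 'k::field) gring" where
  "semigroup_ring d S =
     \<lparr>carrier = {p. Poly_Mapping.keys p \<subseteq> S}, monoid.mult = (*), one = 1, zero = 0, add = (+),
      rcomp = (\<lambda>n. {p. Poly_Mapping.keys p \<subseteq> S \<and>
                       (\<forall>u\<in>Poly_Mapping.keys p. int (fst u + snd u) = n * int d)})\<rparr>"

end

theory Submission
  imports Defs
begin

text \<open>Write \<open>R = K[S]\<close>, let \<open>X\<close> and \<open>Y\<close> be the monomials with exponents \<open>(0, d)\<close> and \<open>(d, 0)\<close>, and
  let \<open>E\<close> be an injective resolution. A torsion cocycle \<open>z\<close> of degree \<open>n\<close> in \<open>E 2\<close> is a coboundary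
  \<open>\<delta> e\<close>, and since powers \<open>X\<^sup>N\<close>, \<open>Y\<^sup>N\<close> annihilate \<open>z\<close>, also \<open>X\<^sup>N e = \<delta> f\<close>, \<open>Y\<^sup>N e = \<delta> g\<close> and
  \<open>Y\<^sup>N f - X\<^sup>N g = \<epsilon> r\<close> with \<open>r \<in> R\<close>. The element \<open>r / (X\<^sup>N Y\<^sup>N)\<close> has degree \<open>n\<close>; if \<open>n d > F\<^sub>1 + F\<^sub>2\<close>, all
  of its monomials belong to \<open>R\<^sub>X\<close> or to \<open>R\<^sub>Y\<close>, whence one can arrange \<open>Y\<^sup>N f = X\<^sup>N g\<close> after enlarging
  \<open>N\<close>. Since \<open>R\<close> has finite colength in \<open>R\<^sub>X \<inter> R\<^sub>Y\<close>, enlarging \<open>N\<close> once more makes \<open>X\<^sup>N \<mapsto> f\<close>, \<open>Y\<^sup>N \<mapsto> g\<close>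
  a well-defined homomorphism from the ideal \<open>(X\<^sup>N, Y\<^sup>N)\<close> to \<open>E 0\<close>. By injectivity it is
  multiplication with some \<open>h\<close>, and \<open>e - \<delta> h\<close> is a torsion element that is mapped to \<open>z\<close>.\<close>

section \<open>Submonoids of the natural numbers\<close>

lemma submonoid_gen_base: "x \<in> A \<Longrightarrow> x \<in> submonoid_gen A"
  using submonoid_gen.add[OF submonoid_gen.zero, of x A] by simp

lemma submonoid_gen_add:
  assumes "x \<in> submonoid_gen A" "y \<in> submonoid_gen A"
  shows "x + y \<in> submonoid_gen A"
  using assms(2) assms(1)
  by (induction y rule: submonoid_gen.induct)
     (auto simp: add.assoc[symmetric] intro: submonoid_gen.intros)

lemma submonoid_gen_mult_nat:
  fixes A :: "nat set"
  shows "x \<in> submonoid_gen A \<Longrightarrow> n * x \<in> submonoid_gen A"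
  by (induction n) (auto intro: submonoid_gen.zero submonoid_gen_add)

text \<open>The residues modulo \<open>d\<close> attained on \<open>submonoid_gen A\<close> form a subgroup, whose smallest positive
  representative \<open>g\<close> divides every element of \<open>A\<close>.\<close>

lemma submonoid_gen_cofinite:
  fixes A :: "nat set"
  assumes d: "d \<in> A" "d > 0" and gcd: "Gcd A = 1"
  shows "\<exists>N. \<forall>n\<ge>N. n \<in> submonoid_gen A"
proof -
  let ?M = "submonoid_gen A"
  define H where "H = {x. \<exists>y\<in>?M. y mod d = x mod d}"
  define g where "g = (LEAST x. 0 < x \<and> x \<in> H)"
  have H_add: "x + y \<in> H" if "x \<in> H" "y \<in> H" for x y
    using that unfolding H_def by (blast intro: submonoid_gen_add mod_add_cong)
  have H_mult: "n * x \<in> H" if "x \<in> H" for x n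
    using that unfolding H_def by (blast intro: submonoid_gen_mult_nat mod_mult_cong)
  have H_cong: "x \<in> H" if "y \<in> H" "x mod d = y mod d" for x y
    using that unfolding H_def by auto
  have H_gen: "x \<in> H" if "x \<in> ?M" for x
    using that unfolding H_def by auto
  have "0 < d \<and> d \<in> H"
    using d H_gen submonoid_gen_base by blast
  then have g: "0 < g" "g \<in> H" and g_least: "\<And>x. 0 < x \<Longrightarrow> x \<in> H \<Longrightarrow> g \<le> x"
    unfolding g_def by - ((drule LeastI, blast)+, auto intro: Least_le)
  have "g dvd b" if "b \<in> A" for b
  proof -
    \<comment> \<open>Modulo \<open>d\<close>, subtracting \<open>b div g * g\<close> from
      \<open>b\<close> amounts to adding it \<open>d - 1\<close> times, which does not leave
      \<open>H\<close>.\<close>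
    have "b mod g + d * (b div g * g) = b + (d - 1) * (b div g * g)"
    proof -
      have "d * (b div g * g) = b div g * g + (d - 1) * (b div g * g)"
        using d(2) by (metis Suc_diff_1 mult_Suc)
      then show ?thesis using mod_div_mult_eq[of b g] by linarith
    qed
    moreover have "b + (d - 1) * (b div g * g) \<in> H"
      using that g by (intro H_add H_mult) (auto intro: H_gen submonoid_gen_base)
    ultimately have "b mod g \<in> H"
      by (metis H_cong mod_mult_self2)
    then have "b mod g = 0"
      using g_least[of "b mod g"] g(1) by (metis leD mod_less_divisor neq0_conv)
    then show ?thesis by auto
  qed
  then have "g dvd Gcd A" by (rule Gcd_greatest)
  then have "1 \<in> H" using gcd g by simp
  then obtain y where y: "y \<in> ?M" "y mod d = 1 mod d" unfolding H_def by auto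
  \<comment> \<open>\<open>n mod d\<close> copies of \<open>y\<close> have the residue of
    \<open>n\<close> and sum to at most \<open>d * y\<close>; the rest is filled up with copies of
    \<open>d\<close>.\<close>
  have "n \<in> ?M" if "n \<ge> d * y" for n
  proof -
    let ?r = "n mod d"
    have "(?r * y) mod d = n mod d"
      using y(2) by (metis mod_mod_trivial mod_mult_right_eq mult.right_neutral)
    moreover have le: "?r * y \<le> n"
      using that d(2) by (meson le_trans less_imp_le mod_less_divisor mult_le_mono1)
    ultimately have "d dvd n - ?r * y"
      by (metis mod_eq_dvd_iff_nat)
    then obtain j where "n - ?r * y = d * j" by (elim dvdE)
    then have "n = ?r * y + j * d" using le by (simp add: mult.commute)
    then show ?thesis
      using y(1) d by (metis submonoid_gen_add submonoid_gen_base submonoid_gen_mult_nat)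
  qed
  then show ?thesis by blast
qed

text \<open>The maximum behind \<open>GREATEST\<close> exists because cofiniteness puts all gaps
  below some \<open>N\<close>.\<close>

lemma mem_submonoid_gen_if_gt_frobenius_number:
  fixes A :: "nat set"
  assumes "d \<in> A" "d > 0" "Gcd A = 1" and z: "z > frobenius_number A"
  shows "z \<in> int ` submonoid_gen A"
proof (rule ccontr)
  assume *: "z \<notin> int ` submonoid_gen A"
  obtain N where N: "\<And>n. n \<ge> N \<Longrightarrow> n \<in> submonoid_gen A"
    using submonoid_gen_cofinite[OF assms(1-3)] by blast
  define P where "P = (\<lambda>z. z \<notin> int ` submonoid_gen A)"
  have bound: "y < int N" if "P y" for y
  proof (rule ccontr)
    assume "\<not> y < int N"
    then have "y = int (nat y)" "nat y \<in> submonoid_gen A" using N[of "nat y"] by auto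
    then show False using that unfolding P_def by blast
  qed
  \<comment> \<open>Counting downwards from \<open>N\<close> turns the greatest gap into a least
    natural number.\<close>
  let ?Q = "\<lambda>m. P (int N - int m)"
  have "?Q (nat (int N - z))"
    using * bound[of z] unfolding P_def by auto
  then have Q: "?Q (LEAST m. ?Q m)" by (rule LeastI)
  have "(GREATEST z. P z) = int N - int (LEAST m. ?Q m)"
  proof (rule Greatest_equality)
    show "?Q (LEAST m. ?Q m)" by (rule Q)
  next
    fix y assume "P y"
    then have "?Q (nat (int N - y))" using bound[of y] by auto
    then have "(LEAST m. ?Q m) \<le> nat (int N - y)" by (rule Least_le)
    then show "y \<le> int N - int (LEAST m. ?Q m)" using bound[OF \<open>P y\<close>] by linarith
  qed
  moreover have "z \<le> int N - int (LEAST m. ?Q m)"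
  proof -
    have "?Q (nat (int N - z))" using * bound[of z] unfolding P_def by auto
    then have "(LEAST m. ?Q m) \<le> nat (int N - z)" by (rule Least_le)
    then show ?thesis using bound[of z] * unfolding P_def by linarith
  qed
  ultimately show False using z unfolding frobenius_number_def P_def by linarith
qed

section \<open>Projective monomial curves\<close>

text \<open>Indexed by a set instead of a sequence: reflecting \<open>B\<close> at \<open>d\<close>
  then exchanges the coordinates, and each fact about first coordinates yields one about second
  coordinates.\<close>

definition proj_monoid :: "nat \<Rightarrow> nat set \<Rightarrow> (nat \<times> nat) set" where
  "proj_monoid d B = submonoid_gen ((\<lambda>b. (b, d - b)) ` B)"

lemma proj_monoid_swap:
  assumes "B \<subseteq> {..d}" "u \<in> proj_monoid d B"
  shows "prod.swap u \<in> proj_monoid d ((\<lambda>b. d - b) ` B)"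
  using assms(2) unfolding proj_monoid_def
proof (induction u rule: submonoid_gen.induct)
  case zero
  then show ?case using submonoid_gen.zero[where 'a = "nat \<times> nat"] by (simp add: zero_prod_def)
next
  case (add x y)
  then obtain b where b: "b \<in> B" "y = (b, d - b)" by auto
  then have "d - (d - b) = b" using assms(1) by auto
  then have "(d - b, b) \<in> (\<lambda>b. (b, d - b)) ` ((\<lambda>b. d - b) ` B)"
    using b by force
  then have "prod.swap x + (d - b, b) \<in> submonoid_gen ((\<lambda>b. (b, d - b)) ` ((\<lambda>b. d - b) ` B))"
    using add.IH by (rule submonoid_gen.add[rotated])
  then show ?case using b by (cases x) simp
qed

lemma proj_monoid_fst:
  assumes "B \<subseteq> {..d}" "u \<in> proj_monoid d B"
  shows "fst u \<in> submonoid_gen B \<and> d dvd fst u + snd u"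
  using assms(2) unfolding proj_monoid_def
proof (induction u rule: submonoid_gen.induct)
  case zero
  then show ?case using submonoid_gen.zero by simp
next
  case (add x y)
  then obtain b where b: "b \<in> B" "y = (b, d - b)" by auto
  with assms(1) have "fst (x + y) + snd (x + y) = (fst x + snd x) + d" by auto
  then have "d dvd fst (x + y) + snd (x + y)" using add.IH by (metis dvd_add_triv_right_iff)
  then show ?case
    using add.IH b submonoid_gen.add[of "fst x" B b] by simp
qed

text \<open>The number \<open>n\<close> of summands is recorded because it becomes the degree of the
  element \<open>(x, n * d - x)\<close> of the monoid.\<close>

inductive sum_of :: "nat set \<Rightarrow> nat \<Rightarrow> nat \<Rightarrow> bool" for B where
  "sum_of B 0 0"
| "sum_of B n x \<Longrightarrow> b \<in> B \<Longrightarrow> sum_of B (Suc n) (x + b)"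

lemma sum_of_add:
  assumes "sum_of B n x" "sum_of B m y"
  shows "sum_of B (n + m) (x + y)"
  using assms(2) assms(1)
  by induction (auto simp: add.assoc[symmetric] intro: sum_of.intros)

lemma sum_of_mult:
  assumes "b \<in> B"
  shows "sum_of B n (n * b)"
proof (induction n)
  case (Suc n)
  then show ?case using sum_of.intros(2)[OF Suc assms] by (simp add: add.commute)
qed (simp add: sum_of.intros)

lemma sum_of_mono: "0 \<in> B \<Longrightarrow> sum_of B n x \<Longrightarrow> n \<le> m \<Longrightarrow> sum_of B m x"
  using sum_of_add[of B n x "m - n" 0] sum_of_mult[of 0 B "m - n"] by simp

lemma sum_of_exists: "x \<in> submonoid_gen B \<Longrightarrow> \<exists>n. sum_of B n x"
  by (induction rule: submonoid_gen.induct) (auto intro: sum_of.intros)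

lemma sum_of_proj_monoid:
  assumes "B \<subseteq> {..d}" "sum_of B n x"
  shows "x \<le> n * d \<and> (x, n * d - x) \<in> proj_monoid d B"
  using assms(2)
proof induction
  case 1
  then show ?case using submonoid_gen.zero[where 'a = "nat \<times> nat"] by (simp add: proj_monoid_def zero_prod_def)
next
  case (2 n x b)
  then have "b \<le> d" using assms(1) by auto
  then have "(x, n * d - x) + (b, d - b) = (x + b, Suc n * d - (x + b))" using 2 by auto
  then show ?case
    using 2 \<open>b \<le> d\<close> submonoid_gen.add[of "(x, n * d - x)" "(\<lambda>b. (b, d - b)) ` B" "(b, d - b)"]
    by (auto simp: proj_monoid_def)
qed

text \<open>Every element of \<open>submonoid_gen B\<close> is the smallest one in its residue class modulo \<open>d\<close> plus a
  multiple of \<open>d\<close>, and there are only finitely many residue classes.\<close>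

lemma proj_monoid_conductor:
  assumes B: "B \<subseteq> {..d}" "0 \<in> B" "d \<in> B" and d: "d > 0"
  shows "\<exists>L0. \<forall>L\<ge>L0. \<forall>x y. x \<in> submonoid_gen B \<longrightarrow> d dvd x + y \<longrightarrow> (x, y + L * d) \<in> proj_monoid d B"
proof -
  let ?P = "\<lambda>r x. x \<in> submonoid_gen B \<and> x mod d = r"
  \<comment> \<open>For a residue class that \<open>submonoid_gen B\<close> misses,
    \<open>m r\<close> and \<open>l r\<close> are arbitrary; this can only enlarge the maximum
    \<open>L0\<close>.\<close>
  define m where "m r = (LEAST x. ?P r x)" for r
  define l where "l r = (SOME n. sum_of B n (m r))" for r
  define L0 where "L0 = Max (l ` {..<d})"
  have "(x, y + L * d) \<in> proj_monoid d B"
    if L: "L \<ge> L0" and x: "x \<in> submonoid_gen B" and y: "d dvd x + y" for x y L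
  proof -
    define r where "r = x mod d"
    have "?P r x" using x r_def by simp
    then have m: "?P r (m r)" and "m r \<le> x"
      unfolding m_def by (rule LeastI, rule Least_le)
    then have "d dvd x - m r" using r_def by (metis mod_eq_dvd_iff_nat)
    then obtain j where j: "x - m r = d * j" by (elim dvdE)
    then have x_eq: "x = m r + j * d" using \<open>m r \<le> x\<close> by (simp add: mult.commute)
    have "sum_of B (l r) (m r)"
      unfolding l_def using sum_of_exists m by (metis someI_ex)
    moreover have "l r \<le> L"
      using L d by (auto simp: L0_def r_def intro: order_trans[rotated] Max_ge)
    ultimately have "sum_of B L (m r)" using sum_of_mono B by blast
    then have s: "sum_of B (L + j) x"
      using sum_of_add sum_of_mult B x_eq by blast
    obtain n where n: "x + y = d * n" using y by (elim dvdE)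
    \<comment> \<open>\<open>j * d \<le> x \<le> n * d\<close> bounds \<open>j\<close> by
      \<open>n\<close>. Padding the sum with zeros to \<open>n + L\<close> summands makes the second
      coordinate exactly \<open>y + L * d\<close>.\<close>
    have "j * d \<le> n * d" using n x_eq by (metis le_add1 le_add2 le_trans mult.commute)
    then have "j \<le> n" using d by (metis mult_le_cancel2)
    then have "sum_of B (n + L) x" using sum_of_mono[OF B(2) s] by simp
    then have "(x, (n + L) * d - x) \<in> proj_monoid d B" using sum_of_proj_monoid B by blast
    moreover have "(n + L) * d - x = y + L * d" using n by (simp add: algebra_simps)
    ultimately show ?thesis by simp
  qed
  then show ?thesis by blast
qed

lemma curve_monoid_eq_proj_monoid: "curve_monoid k a = proj_monoid (a k) (a ` {0..k})"
  by (simp add: curve_monoid_def proj_monoid_def image_image)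

section \<open>Monomials\<close>

text \<open>Cancellation among the exponents leaves a single term of the convolution sum.\<close>

lemma lookup_single_mult:
  fixes q :: "'a::cancel_comm_monoid_add \<Rightarrow>\<^sub>0 'b::semiring_1"
  shows "Poly_Mapping.lookup (Poly_Mapping.single u c * q) (u + v) = c * Poly_Mapping.lookup q v"
  by (simp add: lookup_mult lookup_single when_mult eq_commute[of u])

abbreviation monomial :: "'a \<Rightarrow> 'a \<Rightarrow>\<^sub>0 'b::zero_neq_one" where "monomial u \<equiv> Poly_Mapping.single u 1"

lemma keys_monomial_mult:
  fixes q :: "'a::cancel_comm_monoid_add \<Rightarrow>\<^sub>0 'b::semiring_1"
  shows "Poly_Mapping.keys (monomial u * q) = (+) u ` Poly_Mapping.keys q"
proof
  show "Poly_Mapping.keys (monomial u * q) \<subseteq> (+) u ` Poly_Mapping.keys q"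
    using keys_mult[of "monomial u" q] by (auto split: if_splits)
qed (auto simp: in_keys_iff lookup_single_mult)

lemma monomial_mult_cancel:
  fixes q :: "'a::cancel_comm_monoid_add \<Rightarrow>\<^sub>0 'b::semiring_1"
  shows "monomial u * q = monomial u * q' \<longleftrightarrow> q = q'"
  by (metis lookup_single_mult mult_1 poly_mapping_eqI)

text \<open>Division by the monomial with exponent \<open>u\<close>; terms that it does not divide
  are dropped.\<close>

definition monomial_quot :: "'a::cancel_comm_monoid_add \<Rightarrow> ('a \<Rightarrow>\<^sub>0 'b::zero) \<Rightarrow> 'a \<Rightarrow>\<^sub>0 'b" where
  "monomial_quot u = Poly_Mapping.map_key ((+) u)"

lemma keys_monomial_quot: "Poly_Mapping.keys (monomial_quot u p) = {v. u + v \<in> Poly_Mapping.keys p}"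
  unfolding monomial_quot_def by (subst keys_map_key) auto

lemma monomial_mult_quot:
  fixes p :: "'a::cancel_comm_monoid_add \<Rightarrow>\<^sub>0 'b::semiring_1"
  assumes "\<And>w. w \<in> Poly_Mapping.keys p \<Longrightarrow> \<exists>v. w = u + v"
  shows "monomial u * monomial_quot u p = p"
proof (rule poly_mapping_eqI)
  fix w
  show "Poly_Mapping.lookup (monomial u * monomial_quot u p) w = Poly_Mapping.lookup p w"
  proof (cases "\<exists>v. w = u + v")
    case True
    then show ?thesis by (auto simp: lookup_single_mult monomial_quot_def map_key.rep_eq)
  next
    case False
    then have "w \<notin> Poly_Mapping.keys p" "w \<notin> Poly_Mapping.keys (monomial u * monomial_quot u p)"
      using assms by (auto simp: keys_monomial_mult)
    then show ?thesis by (simp add: in_keys_iff)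
  qed
qed

definition restrict_keys :: "'a set \<Rightarrow> ('a \<Rightarrow>\<^sub>0 'b::zero) \<Rightarrow> 'a \<Rightarrow>\<^sub>0 'b" where
  "restrict_keys X = Poly_Mapping.mapp (\<lambda>u c. c when u \<in> X)"

lemma lookup_restrict_keys: "Poly_Mapping.lookup (restrict_keys X p) u = (Poly_Mapping.lookup p u when u \<in> X)"
  unfolding restrict_keys_def by (auto simp: mapp.rep_eq in_keys_iff when_def)

lemma keys_restrict_keys: "Poly_Mapping.keys (restrict_keys X p) = Poly_Mapping.keys p \<inter> X"
  by (auto simp: in_keys_iff lookup_restrict_keys)

lemma restrict_keys_add_compl:
  fixes p :: "'a \<Rightarrow>\<^sub>0 'b::monoid_add"
  shows "restrict_keys X p + restrict_keys (- X) p = p"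
  by (rule poly_mapping_eqI) (auto simp: lookup_add lookup_restrict_keys when_def)

section \<open>Graded modules\<close>

text \<open>The component of degree \<open>n\<close> of \<open>x\<close> serves as preimage: the
  images of the components of \<open>x\<close> decompose \<open>f x\<close>, and so does
  \<open>f x\<close> alone, hence uniqueness of the decomposition identifies the two.\<close>

lemma graded_hom_homogeneous_preimage:
  assumes M: "graded_module R M" and N: "graded_module R N" and f: "graded_hom R M N f"
    and x: "x \<in> carrier M" "f x \<in> mcomp N n"
  shows "\<exists>y\<in>mcomp M n. f y = f x"
proof -
  interpret M: Module.module R M using M by (simp add: graded_module_def)
  interpret N: Module.module R N using N by (simp add: graded_module_def)
  have f_closed: "f y \<in> carrier N" if "y \<in> carrier M" for y
    using f that by (auto simp: graded_hom_def)
  have f_add: "f (y \<oplus>\<^bsub>M\<^esub> z) = f y \<oplus>\<^bsub>N\<^esub> f z" if "y \<in> carrier M" "z \<in> carrier M" for y z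
    using f that by (auto simp: graded_hom_def)
  have f_zero: "f \<zero>\<^bsub>M\<^esub> = \<zero>\<^bsub>N\<^esub>"
    using f_add[of "\<zero>\<^bsub>M\<^esub>" "\<zero>\<^bsub>M\<^esub>"] f_closed[of "\<zero>\<^bsub>M\<^esub>"] N.M.add.r_cancel_one' by fastforce
  have f_comp: "f y \<in> mcomp N m" if "y \<in> mcomp M m" for y m
    using f that by (force simp: graded_hom_def)
  have Mc: "y \<in> carrier M" if "y \<in> mcomp M m" for y m
    using M that additive_subgroup.a_subset by (fastforce simp: graded_module_def)
  have Nc: "y \<in> carrier N" if "y \<in> mcomp N m" for y m
    using N that additive_subgroup.a_subset by (fastforce simp: graded_module_def)
  have N0: "\<zero>\<^bsub>N\<^esub> \<in> mcomp N m" for m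
    using N additive_subgroup.zero_closed by (fastforce simp: graded_module_def)
  have f_finsum: "f (finsum M c A) = finsum N (\<lambda>m. f (c m)) A"
    if "finite A" "\<And>m. c m \<in> carrier M" for A and c :: "int \<Rightarrow> _"
    using that(1)
  proof induction
    case (insert j A)
    then show ?case using that(2) by (simp add: f_add f_closed Pi_def)
  qed (simp add: f_zero)
  obtain c where c: "\<And>m. c m \<in> mcomp M m" "finite {m. c m \<noteq> \<zero>\<^bsub>M\<^esub>}"
    "x = (\<Oplus>\<^bsub>M\<^esub>m\<in>{m. c m \<noteq> \<zero>\<^bsub>M\<^esub>}. c m)"
    using M x(1) unfolding graded_module_def by meson
  let ?A = "{m. c m \<noteq> \<zero>\<^bsub>M\<^esub>}" and ?fc = "\<lambda>m. f (c m)"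
  let ?s = "\<lambda>m. if m = n then f x else \<zero>\<^bsub>N\<^esub>"
  have sub: "{m. ?fc m \<noteq> \<zero>\<^bsub>N\<^esub>} \<subseteq> ?A" by (auto simp: f_zero)
  have "f x = (\<Oplus>\<^bsub>N\<^esub>m\<in>?A. ?fc m)"
    using c f_finsum[of ?A c] Mc by auto
  \<comment> \<open>The support can shrink, since \<open>f\<close> may kill components of
    \<open>x\<close>.\<close>
  also have "\<dots> = (\<Oplus>\<^bsub>N\<^esub>m\<in>{m. ?fc m \<noteq> \<zero>\<^bsub>N\<^esub>}. ?fc m)"
    using sub c f_closed[OF Mc] by (intro N.M.add.finprod_mono_neutral_cong_right) auto
  finally have 1: "(\<forall>m. ?fc m \<in> mcomp N m) \<and> finite {m. ?fc m \<noteq> \<zero>\<^bsub>N\<^esub>} \<and> f x = \<dots>"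
    using c f_comp sub finite_subset by blast
  have "(\<Oplus>\<^bsub>N\<^esub>m\<in>{m. ?s m \<noteq> \<zero>\<^bsub>N\<^esub>}. ?s m) = (\<Oplus>\<^bsub>N\<^esub>m\<in>{n}. ?s m)"
    using Nc[OF x(2)] by (intro N.M.add.finprod_mono_neutral_cong_left) auto
  also have "\<dots> = f x" using Nc[OF x(2)] by simp
  finally have 2: "(\<forall>m. ?s m \<in> mcomp N m) \<and> finite {m. ?s m \<noteq> \<zero>\<^bsub>N\<^esub>}
      \<and> f x = (\<Oplus>\<^bsub>N\<^esub>m\<in>{m. ?s m \<noteq> \<zero>\<^bsub>N\<^esub>}. ?s m)"
    using x(2) N0 by auto
  have ex1: "\<exists>!c. (\<forall>m. c m \<in> mcomp N m) \<and> finite {m. c m \<noteq> \<zero>\<^bsub>N\<^esub>} \<and>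
      f x = (\<Oplus>\<^bsub>N\<^esub>m\<in>{m. c m \<noteq> \<zero>\<^bsub>N\<^esub>}. c m)"
    using N Nc[OF x(2)] by (simp add: graded_module_def)
  have "?fc = ?s"
    by (rule trans[OF the1_equality[where a = ?fc, OF ex1 1, symmetric]
          the1_equality[where a = ?s, OF ex1 2]])
  then have "f (c n) = f x" by (metis (mono_tags, lifting))
  then show ?thesis using c by blast
qed

section \<open>Monoid algebras with two parameters\<close>

text \<open>\<open>(0, d)\<close> and \<open>(d, 0)\<close> are the exponents of the parameters \<open>X\<close> and \<open>Y\<close>. The exponents of the
  localisations \<open>R\<^sub>X\<close> and \<open>R\<^sub>Y\<close> are the elements of \<open>S1 \<times> \<int>\<close> and of \<open>\<int> \<times> S2\<close> whose coordinate sum is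
  divisible by \<open>d\<close>. A single power \<open>X\<^sup>L\<close> or \<open>Y\<^sup>L\<close> moves the part of them with nonnegative coordinates
  into \<open>S\<close>.\<close>

locale conductor_monoid =
  fixes S :: "(nat \<times> nat) set" and d L :: nat and S1 S2 :: "nat set"
  assumes d_pos: "d > 0"
    and S_zero: "0 \<in> S"
    and S_add: "u \<in> S \<Longrightarrow> v \<in> S \<Longrightarrow> u + v \<in> S"
    and S_X: "(0, d) \<in> S" and S_Y: "(d, 0) \<in> S"
    and S_dvd: "u \<in> S \<Longrightarrow> d dvd fst u + snd u"
    and S_fst: "u \<in> S \<Longrightarrow> fst u \<in> S1" and S_snd: "u \<in> S \<Longrightarrow> snd u \<in> S2"
    and S_conductor1: "x \<in> S1 \<Longrightarrow> d dvd x + y \<Longrightarrow> (x, y + L * d) \<in> S"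
    and S_conductor2: "y \<in> S2 \<Longrightarrow> d dvd x + y \<Longrightarrow> (x + L * d, y) \<in> S"
begin

section \<open>The ring \<open>R\<close>, its grading and its parameters\<close>

abbreviation R :: "((nat \<times> nat) \<Rightarrow>\<^sub>0 'k::field) gring" where "R \<equiv> semigroup_ring d S"

lemma mem_carrier_R: "p \<in> carrier R \<longleftrightarrow> Poly_Mapping.keys p \<subseteq> S"
  by (simp add: semigroup_ring_def)

lemma R_simps [simp]:
  "\<one>\<^bsub>R\<^esub> = 1" "\<zero>\<^bsub>R\<^esub> = 0" "p \<otimes>\<^bsub>R\<^esub> q = p * q" "p \<oplus>\<^bsub>R\<^esub> q = p + q"
  by (simp_all add: semigroup_ring_def)

text \<open>Used with \<open>T = S\<close> for the ring \<open>R\<close> itself and with an ideal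
  \<open>T\<close> of the monoid \<open>S\<close> for the modules spanned by monomials.\<close>

lemma keys_mult_subset:
  assumes "Poly_Mapping.keys p \<subseteq> S" "Poly_Mapping.keys q \<subseteq> T" "\<And>u v. u \<in> S \<Longrightarrow> v \<in> T \<Longrightarrow> u + v \<in> T"
  shows "Poly_Mapping.keys (p * q :: (nat \<times> nat) \<Rightarrow>\<^sub>0 'k::field) \<subseteq> T"
  using keys_mult[of p q] assms by blast

lemma carrier_R [simp]:
  "p \<in> carrier R \<Longrightarrow> q \<in> carrier R \<Longrightarrow> p * q \<in> carrier R"
  "p \<in> carrier R \<Longrightarrow> q \<in> carrier R \<Longrightarrow> p + q \<in> carrier R"
  "p \<in> carrier R \<Longrightarrow> q \<in> carrier R \<Longrightarrow> p - q \<in> carrier R"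
  "p \<in> carrier R \<Longrightarrow> - p \<in> carrier R"
  "0 \<in> carrier R" "1 \<in> carrier R"
  using keys_mult_subset[of p q S] keys_add[of p q] keys_diff[of p q] S_add S_zero
  by (auto simp: mem_carrier_R)

text \<open>Kept apart from membership in \<open>R\<close>, so that degrees of quotients by
  monomials can be computed independently of it.\<close>

definition homog :: "int \<Rightarrow> ((nat \<times> nat) \<Rightarrow>\<^sub>0 'k::zero) \<Rightarrow> bool" where
  "homog n p \<longleftrightarrow> (\<forall>u\<in>Poly_Mapping.keys p. int (fst u + snd u) = n * int d)"

lemma mem_rcomp_R: "p \<in> rcomp R n \<longleftrightarrow> p \<in> carrier R \<and> homog n p"
  by (simp add: semigroup_ring_def homog_def)

lemma homog_zero [simp]: "homog n 0"
  by (simp add: homog_def)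

lemma homog_add: "homog n p \<Longrightarrow> homog n q \<Longrightarrow> homog n (p + q)"
  using keys_add[of p q] unfolding homog_def by blast

lemma homog_uminus: "homog n (p :: (nat \<times> nat) \<Rightarrow>\<^sub>0 'k::field) \<Longrightarrow> homog n (- p)"
  by (simp add: homog_def)

lemma homog_mult:
  assumes "homog m p" "homog n (q :: (nat \<times> nat) \<Rightarrow>\<^sub>0 'k::field)"
  shows "homog (m + n) (p * q)"
  unfolding homog_def
proof
  fix w assume "w \<in> Poly_Mapping.keys (p * q)"
  then obtain u v where "w = u + v" "u \<in> Poly_Mapping.keys p" "v \<in> Poly_Mapping.keys q"
    using keys_mult[of p q] by blast
  then have "int (fst u + snd u) = m * int d" "int (fst v + snd v) = n * int d"
    using assms by (auto simp: homog_def)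
  then show "int (fst w + snd w) = (m + n) * int d"
    using \<open>w = u + v\<close> by (simp add: algebra_simps)
qed

lemma homog_restrict_keys: "homog n p \<Longrightarrow> homog n (restrict_keys A p)"
  by (auto simp: homog_def keys_restrict_keys)

lemma restrict_keys_carrier: "p \<in> carrier R \<Longrightarrow> restrict_keys A p \<in> carrier R"
  by (auto simp: mem_carrier_R keys_restrict_keys)

lemma cring_R: "cring (R :: ((nat \<times> nat) \<Rightarrow>\<^sub>0 'k::field) gring)"
proof (rule cringI)
  show "abelian_group (R :: ((nat \<times> nat) \<Rightarrow>\<^sub>0 'k) gring)"
  proof (rule abelian_groupI)
    fix x :: "(nat \<times> nat) \<Rightarrow>\<^sub>0 'k" assume "x \<in> carrier R"
    then show "\<exists>y\<in>carrier R. y \<oplus>\<^bsub>R\<^esub> x = \<zero>\<^bsub>R\<^esub>" by (intro bexI[of _ "- x"]) auto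
  qed (auto simp: algebra_simps)
  show "comm_monoid (R :: ((nat \<times> nat) \<Rightarrow>\<^sub>0 'k) gring)" by (rule comm_monoidI) (auto simp: algebra_simps)
qed (auto simp: algebra_simps)

text \<open>Powers of the two parameters are written directly as monomials, which makes their effect
  on supports explicit; \<open>X_power\<close> and \<open>Y_power\<close> relate them to powers in
  the ring.\<close>

abbreviation X :: "nat \<Rightarrow> ((nat \<times> nat) \<Rightarrow>\<^sub>0 'k::field)" where "X m \<equiv> monomial (0, m * d)"
abbreviation Y :: "nat \<Rightarrow> ((nat \<times> nat) \<Rightarrow>\<^sub>0 'k::field)" where "Y m \<equiv> monomial (m * d, 0)"

lemma X_mem_S: "(0, m * d) \<in> S"
proof (induction m)
  case (Suc m)
  then show ?case using S_add[OF S_X, of "(0, m * d)"] by simp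
qed (use S_zero in \<open>simp add: zero_prod_def\<close>)

lemma Y_mem_S: "(m * d, 0) \<in> S"
proof (induction m)
  case (Suc m)
  then show ?case using S_add[OF S_Y, of "(m * d, 0)"] by simp
qed (use S_zero in \<open>simp add: zero_prod_def\<close>)

lemma X_carrier [simp]: "X m \<in> carrier R" and Y_carrier [simp]: "Y m \<in> carrier R"
  using X_mem_S Y_mem_S by (auto simp: mem_carrier_R)

lemma X_add: "X (m + n) = X m * X n" and Y_add: "Y (m + n) = Y m * Y n"
  by (simp_all add: mult_single add_mult_distrib)

lemma homog_X: "homog (int m) (X m)" and homog_Y: "homog (int m) (Y m)"
  by (simp_all add: homog_def)

lemma homog_monomial_quot:
  assumes "homog m p" "fst u + snd u = k * d"
  shows "homog (m - int k) (monomial_quot u p)"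
  unfolding homog_def keys_monomial_quot
proof
  fix v assume "v \<in> {v. u + v \<in> Poly_Mapping.keys p}"
  then have "int (fst (u + v) + snd (u + v)) = m * int d" using assms(1) by (auto simp: homog_def)
  moreover have "int (fst u + snd u) = int k * int d" using assms(2) by simp
  ultimately show "int (fst v + snd v) = (m - int k) * int d" by (simp add: left_diff_distrib)
qed

text \<open>The grading is shifted such that \<open>1\<close> (if it belongs to the ideal) has degree \<open>s\<close>.\<close>

definition monomial_ideal :: "(nat \<times> nat) set \<Rightarrow> int \<Rightarrow> ((nat \<times> nat) \<Rightarrow>\<^sub>0 'k::field, (nat \<times> nat) \<Rightarrow>\<^sub>0 'k) gmodule"
  where
  "monomial_ideal T s =
     \<lparr>carrier = {p. Poly_Mapping.keys p \<subseteq> T}, monoid.mult = (*), one = 1, zero = 0, add = (+),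
      smult = (*), mcomp = (\<lambda>j. {p. Poly_Mapping.keys p \<subseteq> T \<and> homog (j - s) p})\<rparr>"

lemma monomial_ideal_simps [simp]:
  "carrier (monomial_ideal T s) = {p. Poly_Mapping.keys p \<subseteq> T}"
  "\<zero>\<^bsub>monomial_ideal T s\<^esub> = 0" "p \<oplus>\<^bsub>monomial_ideal T s\<^esub> q = p + q"
  "p \<odot>\<^bsub>monomial_ideal T s\<^esub> q = p * q"
  "mcomp (monomial_ideal T s) j = {p. Poly_Mapping.keys p \<subseteq> T \<and> homog (j - s) p}"
  by (simp_all add: monomial_ideal_def)

text \<open>Each monomial has a single degree, so the homogeneous components of an element are its
  restrictions to the exponents of the respective degree.\<close>

lemma graded_module_monomial_ideal:
  assumes T: "T \<subseteq> S" "\<And>u v. u \<in> S \<Longrightarrow> v \<in> T \<Longrightarrow> u + v \<in> T"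
  shows "graded_module R (monomial_ideal T s :: ((nat \<times> nat) \<Rightarrow>\<^sub>0 'k::field, _) gmodule)"
proof -
  let ?M = "monomial_ideal T s :: ((nat \<times> nat) \<Rightarrow>\<^sub>0 'k::field, (nat \<times> nat) \<Rightarrow>\<^sub>0 'k) gmodule"
  have ab: "abelian_group ?M"
  proof (rule abelian_groupI)
    fix x y :: "(nat \<times> nat) \<Rightarrow>\<^sub>0 'k"
    assume "x \<in> carrier ?M"
    then show "\<exists>y\<in>carrier ?M. y \<oplus>\<^bsub>?M\<^esub> x = \<zero>\<^bsub>?M\<^esub>" by (intro bexI[of _ "- x"]) auto
    assume "y \<in> carrier ?M"
    then show "x \<oplus>\<^bsub>?M\<^esub> y \<in> carrier ?M" using keys_add[of x y] \<open>x \<in> carrier ?M\<close> by auto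
  qed (auto simp: algebra_simps)
  interpret M: abelian_group ?M by (rule ab)
  have "Module.module R ?M"
    by (rule moduleI[OF cring_R ab]) (auto simp: mem_carrier_R algebra_simps keys_mult_subset[OF _ _ T(2), THEN subsetD])
  moreover have "additive_subgroup (mcomp ?M n) ?M" for n
  proof (rule additive_subgroupI, rule M.add.subgroupI)
    fix p assume p: "p \<in> mcomp ?M n"
    have "- p \<oplus>\<^bsub>?M\<^esub> p = \<zero>\<^bsub>?M\<^esub>" by simp
    then have minus: "\<ominus>\<^bsub>?M\<^esub> p = - p"
      using M.add.inv_equality[of "- p" p] p by auto
    then show "\<ominus>\<^bsub>?M\<^esub> p \<in> mcomp ?M n"
      using p by (simp add: homog_uminus)
  next
    have "0 \<in> mcomp ?M n" by simp
    then show "mcomp ?M n \<noteq> {}" by blast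
  next
    fix p q assume "p \<in> mcomp ?M n" "q \<in> mcomp ?M n"
    then show "p \<oplus>\<^bsub>?M\<^esub> q \<in> mcomp ?M n" using keys_add[of p q] homog_add by auto
  qed auto
  moreover have "r \<odot>\<^bsub>?M\<^esub> x \<in> mcomp ?M (i + j)" if "r \<in> rcomp R i" "x \<in> mcomp ?M j" for r x i j
    using that homog_mult[of i r "j - s" x] keys_mult_subset[OF _ _ T(2), of r x]
    by (auto simp: mem_rcomp_R mem_carrier_R add_diff_eq)
  moreover have "\<exists>!c. (\<forall>n. c n \<in> mcomp ?M n) \<and> finite {n. c n \<noteq> \<zero>\<^bsub>?M\<^esub>} \<and>
      p = (\<Oplus>\<^bsub>?M\<^esub>n\<in>{n. c n \<noteq> \<zero>\<^bsub>?M\<^esub>}. c n)" if p: "p \<in> carrier ?M" for p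
  proof -
    \<comment> \<open>The shifted degree of the monomial \<open>u\<close>; the division is exact for
      \<open>u\<close> in \<open>T\<close> by \<open>S_dvd\<close>.\<close>
    define g where "g u = s + int ((fst u + snd u) div d)" for u :: "nat \<times> nat"
    have g: "int (fst u + snd u) = (j - s) * int d \<longleftrightarrow> g u = j" if "u \<in> T" for u j
    proof -
      obtain i where "fst u + snd u = d * i" using S_dvd T(1) \<open>u \<in> T\<close> unfolding dvd_def by blast
      then have "int (fst u + snd u) = int i * int d" "g u = s + int i"
        using d_pos by (simp_all add: g_def)
      then show ?thesis using d_pos by auto
    qed
    have gc: "Poly_Mapping.lookup (c j) u = 0" if "c j \<in> mcomp ?M j" "g u \<noteq> j"
      for c :: "int \<Rightarrow> (nat \<times> nat) \<Rightarrow>\<^sub>0 'k" and j u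
    proof (rule ccontr)
      assume "Poly_Mapping.lookup (c j) u \<noteq> 0"
      then have "u \<in> Poly_Mapping.keys (c j)" by (simp add: in_keys_iff)
      then have "u \<in> T" "int (fst u + snd u) = (j - s) * int d" using that(1) by (auto simp: homog_def)
      then show False using g that(2) by blast
    qed
    have sum_eq: "finsum ?M c A = (\<Sum>j\<in>A. c j)"
      if "finite A" "\<And>j. c j \<in> carrier ?M" for c A
      using that by induction (simp_all add: Pi_def)
    \<comment> \<open>At the exponent \<open>u\<close> only the component of degree
      \<open>g u\<close> contributes. This yields existence as well as uniqueness of the
      decomposition.\<close>
    have lk: "Poly_Mapping.lookup (\<Oplus>\<^bsub>?M\<^esub>n\<in>{n. c n \<noteq> \<zero>\<^bsub>?M\<^esub>}. c n) u = Poly_Mapping.lookup (c (g u)) u"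
      if "\<forall>n. c n \<in> mcomp ?M n" "finite {n. c n \<noteq> \<zero>\<^bsub>?M\<^esub>}" for c u
    proof -
      have "Poly_Mapping.lookup (\<Oplus>\<^bsub>?M\<^esub>n\<in>{n. c n \<noteq> \<zero>\<^bsub>?M\<^esub>}. c n) u
          = (\<Sum>j\<in>{n. c n \<noteq> 0}. Poly_Mapping.lookup (c j) u)"
        using that by (subst sum_eq) (auto simp: lookup_sum)
      also have "\<dots> = (\<Sum>j\<in>{n. c n \<noteq> 0}. if g u = j then Poly_Mapping.lookup (c j) u else 0)"
        using that gc[of c] by (intro sum.cong) auto
      also have "\<dots> = Poly_Mapping.lookup (c (g u)) u"
        using that by (subst sum.delta') auto
      finally show ?thesis .
    qed
    show ?thesis
    proof (rule ex1I)
      define c where "c j = restrict_keys {u. g u = j} p" for j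
      have c1: "\<forall>n. c n \<in> mcomp ?M n"
        using p g by (auto simp: c_def keys_restrict_keys homog_def)
      have "c j = 0" if "j \<notin> g ` Poly_Mapping.keys p" for j
      proof -
        have "Poly_Mapping.keys (c j) = {}" using that by (auto simp: c_def keys_restrict_keys)
        then show ?thesis by simp
      qed
      then have "{n. c n \<noteq> \<zero>\<^bsub>?M\<^esub>} \<subseteq> g ` Poly_Mapping.keys p" by auto
      then have c2: "finite {n. c n \<noteq> \<zero>\<^bsub>?M\<^esub>}" by (rule finite_subset) simp
      have "p = (\<Oplus>\<^bsub>?M\<^esub>n\<in>{n. c n \<noteq> \<zero>\<^bsub>?M\<^esub>}. c n)"
        by (rule poly_mapping_eqI, subst lk[OF c1 c2]) (simp add: c_def lookup_restrict_keys)
      then show "(\<forall>n. c n \<in> mcomp ?M n) \<and> finite {n. c n \<noteq> \<zero>\<^bsub>?M\<^esub>} \<and>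
          p = (\<Oplus>\<^bsub>?M\<^esub>n\<in>{n. c n \<noteq> \<zero>\<^bsub>?M\<^esub>}. c n)"
        using c1 c2 by blast
      fix c' assume c': "(\<forall>n. c' n \<in> mcomp ?M n) \<and> finite {n. c' n \<noteq> \<zero>\<^bsub>?M\<^esub>} \<and>
          p = (\<Oplus>\<^bsub>?M\<^esub>n\<in>{n. c' n \<noteq> \<zero>\<^bsub>?M\<^esub>}. c' n)"
      show "c' = c"
      proof (rule ext, rule poly_mapping_eqI)
        fix j u
        show "Poly_Mapping.lookup (c' j) u = Poly_Mapping.lookup (c j) u"
        proof (cases "g u = j")
          case True
          moreover have "Poly_Mapping.lookup p u = Poly_Mapping.lookup (c' (g u)) u"
            using lk[OF conjunct1[OF c'] conjunct1[OF conjunct2[OF c']]]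
            unfolding conjunct2[OF conjunct2[OF c'], symmetric] .
          ultimately show ?thesis by (simp add: c_def lookup_restrict_keys)
        next
          case False
          then show ?thesis using gc[of c' j u] conjunct1[OF c'] by (simp add: c_def lookup_restrict_keys)
        qed
      qed
    qed
  qed
  ultimately show ?thesis unfolding graded_module_def by blast
qed

section \<open>The ideal generated by \<open>X N\<close> and \<open>Y N\<close>, with exponent set
  \<open>cone N\<close>\<close>

definition cone :: "nat \<Rightarrow> (nat \<times> nat) set" where
  "cone N = (+) (0, N * d) ` S \<union> (+) (N * d, 0) ` S"

lemma cone_subset: "cone N \<subseteq> S"
  using S_add[OF X_mem_S] S_add[OF Y_mem_S] unfolding cone_def by blast

lemma cone_add:
  assumes "u \<in> S" "v \<in> cone N"
  shows "u + v \<in> cone N"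
proof -
  obtain x w where "x = (0, N * d) \<or> x = (N * d, 0)" "w \<in> S" "v = x + w"
    using assms(2) unfolding cone_def by blast
  moreover from this have "u + v = x + (u + w)" by (simp only: add.left_commute)
  ultimately show ?thesis using S_add[OF assms(1)] unfolding cone_def by blast
qed

text \<open>The monomials that \<open>X N\<close> divides within \<open>R\<close> go to
  \<open>a\<close>, the remaining ones to \<open>b\<close>. Restriction and division by monomials
  respect degrees, so this choice also serves homogeneous \<open>p\<close>.\<close>

lemma cone_decomposition:
  fixes p :: "(nat \<times> nat) \<Rightarrow>\<^sub>0 'k::field"
  assumes p: "Poly_Mapping.keys p \<subseteq> cone N"
  obtains a b where "a \<in> carrier R" "b \<in> carrier R" "p = X N * a + Y N * b"
    "\<And>s. homog s p \<Longrightarrow> homog (s - int N) a \<and> homog (s - int N) b"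
proof
  let ?T = "(+) (0, N * d) ` S"
  define p1 where "p1 = restrict_keys ?T p"
  define p2 where "p2 = restrict_keys (- ?T) p"
  have keys1: "Poly_Mapping.keys p1 \<subseteq> ?T" and keys2: "Poly_Mapping.keys p2 \<subseteq> (+) (N * d, 0) ` S"
    using p by (auto simp: p1_def p2_def keys_restrict_keys cone_def)
  show "monomial_quot (0, N * d) p1 \<in> carrier R" "monomial_quot (N * d, 0) p2 \<in> carrier R"
    using keys1 keys2 by (fastforce simp: mem_carrier_R keys_monomial_quot)+
  have "X N * monomial_quot (0, N * d) p1 = p1" "Y N * monomial_quot (N * d, 0) p2 = p2"
    using keys1 keys2 by (fastforce intro!: monomial_mult_quot)+
  then show "p = X N * monomial_quot (0, N * d) p1 + Y N * monomial_quot (N * d, 0) p2"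
    by (simp add: p1_def p2_def restrict_keys_add_compl)
  fix s assume "homog s p"
  then show "homog (s - int N) (monomial_quot (0, N * d) p1) \<and> homog (s - int N) (monomial_quot (N * d, 0) p2)"
    by (auto simp: p1_def p2_def intro!: homog_monomial_quot homog_restrict_keys)
qed

text \<open>A syzygy of \<open>(X N, Y N)\<close> becomes a Koszul syzygy after multiplication with \<open>X L\<close> or \<open>Y L\<close>.\<close>

lemma syzygy:
  fixes p q :: "(nat \<times> nat) \<Rightarrow>\<^sub>0 'k::field"
  assumes p: "p \<in> carrier R" and q: "q \<in> carrier R" and eq: "X N * p = Y N * q"
  obtains c where "p = Y N * c" "q = X N * c" "X L * c \<in> carrier R" "Y L * c \<in> carrier R"
proof -
  define c where "c = monomial_quot (N * d, 0) p"
  \<comment> \<open>Comparing supports in \<open>X N * p = Y N * q\<close> shows that every exponent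
    of \<open>p\<close> has first coordinate at least \<open>N * d\<close>, so \<open>Y N\<close>
    divides \<open>p\<close> in the monoid algebra of \<open>\<nat>\<^sup>2\<close>.\<close>
  have split: "\<exists>w\<in>Poly_Mapping.keys q. fst u = N * d + fst w \<and> N * d + snd u = snd w"
    if "u \<in> Poly_Mapping.keys p" for u
  proof -
    have "(0, N * d) + u \<in> Poly_Mapping.keys (X N * p)" using that by (simp add: keys_monomial_mult)
    then obtain w where w: "w \<in> Poly_Mapping.keys q" "(0, N * d) + u = (N * d, 0) + w"
      unfolding eq keys_monomial_mult by blast
    then show ?thesis by (intro bexI[of _ w]) (cases u, cases w, auto)+
  qed
  have "\<exists>v. u = (N * d, 0) + v" if "u \<in> Poly_Mapping.keys p" for u
    using split[OF that] by (intro exI[of _ "(fst u - N * d, snd u)"]) (auto simp: prod_eq_iff)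
  then have pc: "p = Y N * c" unfolding c_def by (metis monomial_mult_quot)
  have "Y N * q = Y N * (X N * c)" using eq pc by (simp add: mult.left_commute)
  then have qc: "q = X N * c" by (simp add: monomial_mult_cancel)
  \<comment> \<open>\<open>c\<close> itself may lie outside \<open>R\<close>. However,
    \<open>Y N * c\<close> and \<open>X N * c\<close> lie in \<open>R\<close>: multiplying by
    \<open>Y N\<close> preserves second coordinates, multiplying by \<open>X N\<close> first
    ones.\<close>
  have v: "fst v \<in> S1" "snd v \<in> S2" "d dvd fst v + snd v" if "v \<in> Poly_Mapping.keys c" for v
  proof -
    have "(N * d, 0) + v \<in> S" "(0, N * d) + v \<in> S"
      using that p q unfolding pc qc mem_carrier_R keys_monomial_mult by blast+
    then have "snd ((N * d, 0) + v) \<in> S2" "fst ((0, N * d) + v) \<in> S1"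
      "d dvd fst ((N * d, 0) + v) + snd ((N * d, 0) + v)"
      using S_fst S_snd S_dvd by blast+
    then show "fst v \<in> S1" "snd v \<in> S2" "d dvd fst v + snd v"
      by (auto simp: add.assoc dvd_add_right_iff)
  qed
  have "(0, L * d) + v \<in> S \<and> (L * d, 0) + v \<in> S" if "v \<in> Poly_Mapping.keys c" for v
    using S_conductor1[OF v(1,3)[OF that]] S_conductor2[OF v(2,3)[OF that]]
    by (cases v) (auto simp: add.commute)
  then have "X L * c \<in> carrier R" "Y L * c \<in> carrier R"
    by (auto simp: mem_carrier_R keys_monomial_mult)
  with pc qc that show ?thesis by blast
qed

text \<open>One coordinate is at least \<open>(N + L) * d\<close>. Of this, \<open>N * d\<close> is
  split off as a power of a parameter, and \<open>L * d\<close> keeps the quotient in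
  \<open>S\<close> by the conductor property.\<close>

lemma mem_cone_if_large:
  assumes "u \<in> S" "2 * (N + L) * d \<le> fst u + snd u"
  shows "u \<in> cone N"
proof (cases "(N + L) * d \<le> snd u")
  case True
  define y where "y = snd u - (N + L) * d"
  have y: "snd u = y + L * d + N * d" using True by (simp add: y_def algebra_simps)
  have "d dvd fst u + y" using S_dvd[OF assms(1)] unfolding y by (simp add: add.assoc[symmetric])
  then have "(fst u, y + L * d) \<in> S" using S_conductor1 S_fst[OF assms(1)] by blast
  moreover have "u = (0, N * d) + (fst u, y + L * d)" using y by (simp add: prod_eq_iff)
  ultimately show ?thesis unfolding cone_def by blast
next
  case False
  then have "(N + L) * d \<le> fst u" using assms(2) by (simp add: algebra_simps)
  define x where "x = fst u - (N + L) * d"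
  have x: "fst u = x + L * d + N * d" using \<open>_ \<le> fst u\<close> by (simp add: x_def algebra_simps)
  have "fst u + snd u = (x + snd u) + (L + N) * d" using x by (simp add: algebra_simps)
  then have "d dvd x + snd u" using S_dvd[OF assms(1)] by (metis dvd_add_left_iff dvd_triv_right)
  then have "(x + L * d, snd u) \<in> S" using S_conductor2 S_snd[OF assms(1)] by blast
  moreover have "u = (N * d, 0) + (x + L * d, snd u)" using x by (simp add: prod_eq_iff)
  ultimately show ?thesis unfolding cone_def by blast
qed

section \<open>Powers of the irrelevant ideal\<close>

text \<open>The elements all of whose terms have degree at least \<open>t\<close>: an explicit upper
  bound for the \<open>t\<close>-th power of the irrelevant ideal.\<close>

definition power_ideal :: "nat \<Rightarrow> ((nat \<times> nat) \<Rightarrow>\<^sub>0 'k::field) set" where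
  "power_ideal t = {p \<in> carrier R. \<forall>u\<in>Poly_Mapping.keys p. t * d \<le> fst u + snd u}"

lemma power_ideal_mult:
  assumes "p \<in> power_ideal s" "q \<in> power_ideal t"
  shows "p * q \<in> power_ideal (s + t)"
proof -
  have "(s + t) * d \<le> fst w + snd w" if w: "w \<in> Poly_Mapping.keys (p * q)" for w
  proof -
    obtain u v where uv: "w = u + v" "u \<in> Poly_Mapping.keys p" "v \<in> Poly_Mapping.keys q"
      using keys_mult[of p q] w by blast
    then have "s * d \<le> fst u + snd u" "t * d \<le> fst v + snd v"
      using assms by (auto simp: power_ideal_def)
    then show ?thesis using uv by (simp add: algebra_simps)
  qed
  then show ?thesis using assms by (simp add: power_ideal_def)
qed

lemma power_ideal_add:
  "p \<in> power_ideal t \<Longrightarrow> q \<in> power_ideal t \<Longrightarrow> p + q \<in> power_ideal t"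
  using keys_add[of p q] by (auto simp: power_ideal_def)

lemma ideal_power_ideal: "ideal (power_ideal t) (R :: ((nat \<times> nat) \<Rightarrow>\<^sub>0 'k::field) gring)"
proof -
  interpret R: cring "R :: ((nat \<times> nat) \<Rightarrow>\<^sub>0 'k) gring" by (rule cring_R)
  have R0: "x \<in> power_ideal 0" if "x \<in> carrier R" for x :: "(nat \<times> nat) \<Rightarrow>\<^sub>0 'k"
    using that by (simp add: power_ideal_def)
  show ?thesis
  proof (rule idealI[OF R.ring_axioms], rule R.add.subgroupI)
    fix p :: "(nat \<times> nat) \<Rightarrow>\<^sub>0 'k" assume p: "p \<in> power_ideal t"
    then have "p \<in> carrier R" by (simp add: power_ideal_def)
    then have minus: "\<ominus>\<^bsub>R\<^esub> p = - p" by (intro R.minus_equality) auto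
    show "\<ominus>\<^bsub>R\<^esub> p \<in> power_ideal t"
      unfolding minus using p by (simp add: power_ideal_def)
  next
    have "0 \<in> power_ideal t" by (simp add: power_ideal_def)
    then show "(power_ideal t :: ((nat \<times> nat) \<Rightarrow>\<^sub>0 'k) set) \<noteq> {}" by blast
  next
    fix a x :: "(nat \<times> nat) \<Rightarrow>\<^sub>0 'k" assume "a \<in> power_ideal t" "x \<in> carrier R"
    then show "x \<otimes>\<^bsub>R\<^esub> a \<in> power_ideal t" "a \<otimes>\<^bsub>R\<^esub> x \<in> power_ideal t"
      using power_ideal_mult[OF R0, of x a t] power_ideal_mult[OF _ R0, of a t x] by auto
  next
    show "power_ideal t \<subseteq> (carrier R :: ((nat \<times> nat) \<Rightarrow>\<^sub>0 'k) set)" by (auto simp: power_ideal_def)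
  qed (simp add: power_ideal_add)
qed

lemma irrelevant_ideal_subset: "irrelevant_ideal R \<subseteq> (power_ideal 1 :: ((nat \<times> nat) \<Rightarrow>\<^sub>0 'k::field) set)"
proof -
  interpret R: cring "R :: ((nat \<times> nat) \<Rightarrow>\<^sub>0 'k) gring" by (rule cring_R)
  have "p \<in> power_ideal 1" if "p \<in> rcomp R n" "1 \<le> n" for n and p :: "(nat \<times> nat) \<Rightarrow>\<^sub>0 'k"
  proof -
    have "d \<le> fst u + snd u" if "u \<in> Poly_Mapping.keys p" for u
    proof -
      have "1 * int d \<le> n * int d" using \<open>1 \<le> n\<close> by (intro mult_right_mono) auto
      also have "\<dots> = int (fst u + snd u)"
        using that \<open>p \<in> rcomp R n\<close> by (simp add: mem_rcomp_R homog_def)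
      finally show ?thesis by simp
    qed
    then show ?thesis using that by (simp add: power_ideal_def mem_rcomp_R)
  qed
  then show ?thesis
    unfolding irrelevant_ideal_def by (intro R.genideal_minimal ideal_power_ideal) auto
qed

lemma irrelevant_ideal_power_subset:
  "irrelevant_ideal R [^]\<^bsub>ideals_set R\<^esub> t \<subseteq> (power_ideal t :: ((nat \<times> nat) \<Rightarrow>\<^sub>0 'k::field) set)"
proof (induction t)
  \<comment> \<open>The neutral element of the product of ideals is the whole ring, so the zeroth
    power is \<open>carrier R\<close>.\<close>
  case 0
  then show ?case by (auto simp: nat_pow_def ideals_set_def power_ideal_def)
next
  case (Suc t)
  have "p \<in> power_ideal (Suc t)" if "p \<in> ideal_prod R (irrelevant_ideal R [^]\<^bsub>ideals_set R\<^esub> t) (irrelevant_ideal R)"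
    for p :: "(nat \<times> nat) \<Rightarrow>\<^sub>0 'k"
    using that
  proof induction
    case (prod i j)
    then show ?case using Suc.IH irrelevant_ideal_subset power_ideal_mult[of i t j 1] by auto
  qed (simp add: power_ideal_add)
  then show ?case by (auto simp: nat_pow_def ideals_set_def)
qed

text \<open>The bound from below: whatever a power of the irrelevant ideal annihilates is
  annihilated by powers of both parameters.\<close>

lemma monomial_mem_irrelevant_ideal_power:
  assumes "u \<in> {(0, d), (d, 0)}"
  shows "(monomial u ^ t :: (nat \<times> nat) \<Rightarrow>\<^sub>0 'k::field) \<in> irrelevant_ideal R [^]\<^bsub>ideals_set R\<^esub> t"
proof (induction t)
  case 0
  then show ?case by (simp add: nat_pow_def ideals_set_def)
next
  case (Suc t)
  interpret R: cring "R :: ((nat \<times> nat) \<Rightarrow>\<^sub>0 'k) gring" by (rule cring_R)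
  have "monomial u \<in> rcomp R 1"
    using assms S_X S_Y by (auto simp: mem_rcomp_R mem_carrier_R homog_def)
  moreover have "(\<Union>n\<in>{1..}. rcomp R n) \<subseteq> irrelevant_ideal (R :: ((nat \<times> nat) \<Rightarrow>\<^sub>0 'k) gring)"
    unfolding irrelevant_ideal_def by (rule R.genideal_self) (auto simp: mem_rcomp_R)
  ultimately have "(monomial u :: (nat \<times> nat) \<Rightarrow>\<^sub>0 'k) \<in> irrelevant_ideal R" by (meson UN_I atLeast_iff in_mono order_refl)
  then have "(monomial u ^ t :: (nat \<times> nat) \<Rightarrow>\<^sub>0 'k) \<otimes>\<^bsub>R\<^esub> monomial u
      \<in> ideal_prod R (irrelevant_ideal R [^]\<^bsub>ideals_set R\<^esub> t) (irrelevant_ideal R)"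
    using Suc.IH by (intro ideal_prod.prod)
  then show ?case by (simp add: nat_pow_def ideals_set_def mult.commute)
qed

lemma X_power: "monomial (0, d) ^ m = X m" and Y_power: "monomial (d, 0) ^ m = Y m"
  by (induction m) (simp_all add: mult_single single_one[symmetric] zero_prod_def del: single_one)

section \<open>Extension from monomial ideals, and the Cech class\<close>

text \<open>\<open>monomial_ideal S s\<close> is \<open>R\<close> with shifted grading. The image
  \<open>h\<close> of \<open>1\<close> under an extension of \<open>\<phi>\<close> to it represents
  \<open>\<phi>\<close> as a multiplication, and \<open>1\<close> has degree \<open>s\<close>
  there.\<close>

lemma extend_from_ideal:
  fixes E :: "((nat \<times> nat) \<Rightarrow>\<^sub>0 'k::field, 'e) gmodule"
  assumes E: "graded_injective R E"
    and T: "T \<subseteq> S" "\<And>u v. u \<in> S \<Longrightarrow> v \<in> T \<Longrightarrow> u + v \<in> T"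
    and \<phi>: "graded_hom R (monomial_ideal T s) E \<phi>"
  obtains h where "h \<in> mcomp E s" "\<And>p. Poly_Mapping.keys p \<subseteq> T \<Longrightarrow> p \<odot>\<^bsub>E\<^esub> h = \<phi> p"
proof -
  let ?M = "monomial_ideal T s :: ((nat \<times> nat) \<Rightarrow>\<^sub>0 'k, (nat \<times> nat) \<Rightarrow>\<^sub>0 'k) gmodule"
  let ?N = "monomial_ideal S s :: ((nat \<times> nat) \<Rightarrow>\<^sub>0 'k, (nat \<times> nat) \<Rightarrow>\<^sub>0 'k) gmodule"
  have ext: "\<exists>g. graded_hom R N E g \<and> (\<forall>x\<in>carrier M. g (j x) = f x)"
    if "graded_module R M" "graded_module R N" "graded_hom R M N j" "inj_on j (carrier M)" "graded_hom R M E f"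
    for M N :: "((nat \<times> nat) \<Rightarrow>\<^sub>0 'k, (nat \<times> nat) \<Rightarrow>\<^sub>0 'k) gmodule" and j f
    using E that unfolding graded_injective_def by blast
  have "graded_hom R ?M ?N (\<lambda>x. x)" using T(1) by (auto simp: graded_hom_def)
  then have "\<exists>g. graded_hom R ?N E g \<and> (\<forall>x\<in>carrier ?M. g x = \<phi> x)"
    using T \<phi> S_add by (intro ext graded_module_monomial_ideal) auto
  then obtain g where g: "graded_hom R ?N E g" "\<And>x. x \<in> carrier ?M \<Longrightarrow> g x = \<phi> x"
    by blast
  show ?thesis
  proof
    have "1 \<in> mcomp ?N s" using S_zero by (simp add: homog_def)
    then show "g 1 \<in> mcomp E s" using g(1) unfolding graded_hom_def by blast
    fix p :: "(nat \<times> nat) \<Rightarrow>\<^sub>0 'k" assume p: "Poly_Mapping.keys p \<subseteq> T"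
    then have "p \<in> carrier R" "1 \<in> carrier ?N" using T(1) S_zero by (auto simp: mem_carrier_R)
    then have "g (p \<odot>\<^bsub>?N\<^esub> 1) = p \<odot>\<^bsub>E\<^esub> g 1" using g(1) unfolding graded_hom_def by blast
    then show "p \<odot>\<^bsub>E\<^esub> g 1 = \<phi> p" using g(2)[of p] p by simp
  qed
qed

text \<open>The class of \<open>r / (X N * Y N)\<close> in \<open>R\<^sub>X\<^sub>Y / (R\<^sub>X + R\<^sub>Y)\<close> vanishes: every exponent lies in
  \<open>S1 \<times> \<int>\<close> or in \<open>\<int> \<times> S2\<close>.\<close>

lemma cech_class_zero:
  fixes r :: "(nat \<times> nat) \<Rightarrow>\<^sub>0 'k::field"
  assumes r: "r \<in> carrier R" "homog (n + 2 * int N) r"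
    and cover: "\<And>x y :: int. x + y = n * int d \<Longrightarrow> x \<in> int ` S1 \<or> y \<in> int ` S2"
  obtains r1 r2 p1 p2 where "r1 \<in> carrier R" "r2 \<in> carrier R" "r = r1 + r2"
    "p1 \<in> carrier R" "p2 \<in> carrier R" "X L * r1 = Y N * p1" "Y L * r2 = X N * p2"
    "homog (n + int (N + L)) p1" "homog (n + int (N + L)) p2"
proof -
  \<comment> \<open>Division by \<open>X N * Y N\<close> lowers both coordinates by
    \<open>N * d\<close>; \<open>A\<close> collects the exponents that end up in
    \<open>S1 \<times> \<int>\<close>.\<close>
  define A where "A = {u :: nat \<times> nat. \<exists>x\<in>S1. fst u = N * d + x}"
  define r1 where "r1 = restrict_keys A r"
  define r2 where "r2 = restrict_keys (- A) r"
  have rR: "r1 \<in> carrier R" "r2 \<in> carrier R" "r = r1 + r2"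
    using r by (simp_all add: r1_def r2_def restrict_keys_carrier restrict_keys_add_compl)
  have hom: "homog (n + 2 * int N) r1" "homog (n + 2 * int N) r2"
    using r by (simp_all add: r1_def r2_def homog_restrict_keys)
  \<comment> \<open>\<open>X L\<close> raises the second coordinate enough for the conductor
    property, so the quotient by \<open>Y N\<close> stays in \<open>S\<close>.\<close>
  have 1: "\<exists>v\<in>S. (0, L * d) + u = (N * d, 0) + v" if u: "u \<in> Poly_Mapping.keys r1" for u
  proof -
    obtain x where x: "x \<in> S1" "fst u = N * d + x" using u by (auto simp: r1_def keys_restrict_keys A_def)
    have "d dvd fst u + snd u" using u rR S_dvd by (auto simp: mem_carrier_R)
    then have "d dvd x + snd u" unfolding x(2) by (simp add: add.assoc)
    then have "(x, snd u + L * d) \<in> S" using S_conductor1 x(1) by blast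
    moreover have "(0, L * d) + u = (N * d, 0) + (x, snd u + L * d)" using x(2) by (simp add: prod_eq_iff)
    ultimately show ?thesis by blast
  qed
  have 2: "\<exists>v\<in>S. (L * d, 0) + u = (0, N * d) + v" if u: "u \<in> Poly_Mapping.keys r2" for u
  proof -
    \<comment> \<open>Outside \<open>A\<close> the first alternative of \<open>cover\<close> fails
      for the lowered exponent, whose coordinate sum is \<open>n * d\<close>; so the second one
      holds.\<close>
    have "int (fst u) - int (N * d) \<notin> int ` S1"
    proof
      assume "int (fst u) - int (N * d) \<in> int ` S1"
      then obtain x where "x \<in> S1" "int (fst u) - int (N * d) = int x" by blast
      then have "x \<in> S1" "fst u = N * d + x" by linarith+
      then show False using u by (auto simp: r2_def keys_restrict_keys A_def)
    qed
    moreover have "int (fst u + snd u) = (n + 2 * int N) * int d" using hom(2) u by (simp add: homog_def)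
    then have "(int (fst u) - int (N * d)) + (int (snd u) - int (N * d)) = n * int d"
      by (simp add: algebra_simps)
    ultimately have "int (snd u) - int (N * d) \<in> int ` S2" using cover by blast
    then obtain y where "y \<in> S2" "int (snd u) - int (N * d) = int y" by blast
    then have y: "y \<in> S2" "snd u = N * d + y" by linarith+
    have "d dvd fst u + snd u" using u rR S_dvd by (auto simp: mem_carrier_R)
    moreover have "fst u + snd u = (fst u + y) + N * d" using y by simp
    ultimately have "d dvd fst u + y" by (metis dvd_add_left_iff dvd_triv_right)
    then have "(fst u + L * d, y) \<in> S" using S_conductor2 y(1) by blast
    moreover have "(L * d, 0) + u = (0, N * d) + (fst u + L * d, y)" using y(2) by (simp add: prod_eq_iff)
    ultimately show ?thesis by blast
  qed
  let ?p1 = "monomial_quot (N * d, 0) (X L * r1)" and ?p2 = "monomial_quot (0, N * d) (Y L * r2)"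
  show ?thesis
  proof (rule that[of r1 r2 ?p1 ?p2])
    show "?p1 \<in> carrier R" "?p2 \<in> carrier R"
      unfolding mem_carrier_R keys_monomial_quot keys_monomial_mult
      using 1 2 by (metis (no_types, lifting) add_left_imp_eq imageE mem_Collect_eq subsetI)+
    show "X L * r1 = Y N * ?p1"
      by (rule monomial_mult_quot[symmetric]) (use 1 in \<open>unfold keys_monomial_mult, blast\<close>)
    show "Y L * r2 = X N * ?p2"
      by (rule monomial_mult_quot[symmetric]) (use 2 in \<open>unfold keys_monomial_mult, blast\<close>)
    have deg: "n + int (N + L) = int L + (n + 2 * int N) - int N" by simp
    show "homog (n + int (N + L)) ?p1" "homog (n + int (N + L)) ?p2"
      unfolding deg by (rule homog_monomial_quot; simp add: homog_mult homog_X homog_Y hom)+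
  qed (use rR in auto)
qed

end

section \<open>Torsion and division by parameters in a graded module\<close>

locale graded_module_over = conductor_monoid S d L S1 S2
  for S d L S1 S2 +
  fixes M :: "((nat \<times> nat) \<Rightarrow>\<^sub>0 'k::field, 'e) gmodule"
  assumes graded: "graded_module R M"
begin

sublocale M: abelian_group M
  using graded by (auto simp: graded_module_def Module.module_def)

lemma module_M: "Module.module R M"
  using graded by (simp add: graded_module_def)

lemma smult:
  assumes "p \<in> carrier R" "x \<in> carrier M"
  shows "p \<odot>\<^bsub>M\<^esub> x \<in> carrier M"
    "y \<in> carrier M \<Longrightarrow> p \<odot>\<^bsub>M\<^esub> (x \<oplus>\<^bsub>M\<^esub> y) = p \<odot>\<^bsub>M\<^esub> x \<oplus>\<^bsub>M\<^esub> p \<odot>\<^bsub>M\<^esub> y"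
    "q \<in> carrier R \<Longrightarrow> (p + q) \<odot>\<^bsub>M\<^esub> x = p \<odot>\<^bsub>M\<^esub> x \<oplus>\<^bsub>M\<^esub> q \<odot>\<^bsub>M\<^esub> x"
    "q \<in> carrier R \<Longrightarrow> (p * q) \<odot>\<^bsub>M\<^esub> x = p \<odot>\<^bsub>M\<^esub> (q \<odot>\<^bsub>M\<^esub> x)"
    "p \<odot>\<^bsub>M\<^esub> (\<ominus>\<^bsub>M\<^esub> x) = \<ominus>\<^bsub>M\<^esub> (p \<odot>\<^bsub>M\<^esub> x)"
  using module.smult_closed[OF module_M] module.smult_r_distr[OF module_M]
    module.smult_l_distr[OF module_M, of p q] module.smult_assoc1[OF module_M, of p q] module.smult_r_minus[OF module_M] assms
  by auto

lemma smult_trivial: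
  shows "x \<in> carrier M \<Longrightarrow> 1 \<odot>\<^bsub>M\<^esub> x = x"
    and "x \<in> carrier M \<Longrightarrow> 0 \<odot>\<^bsub>M\<^esub> x = \<zero>\<^bsub>M\<^esub>"
    and "p \<in> carrier R \<Longrightarrow> p \<odot>\<^bsub>M\<^esub> \<zero>\<^bsub>M\<^esub> = \<zero>\<^bsub>M\<^esub>"
  using module.smult_one[OF module_M] module.smult_l_null[OF module_M] module.smult_r_null[OF module_M]
  by auto

lemma comp_sub: "additive_subgroup (mcomp M n) M"
  using graded by (simp add: graded_module_def)

lemma comp_closed: "x \<in> mcomp M n \<Longrightarrow> x \<in> carrier M"
  using additive_subgroup.a_subset[OF comp_sub] by blast

lemma comp_add: "x \<in> mcomp M n \<Longrightarrow> y \<in> mcomp M n \<Longrightarrow> x \<oplus>\<^bsub>M\<^esub> y \<in> mcomp M n"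
  using additive_subgroup.a_closed[OF comp_sub] by blast

lemma comp_uminus: "x \<in> mcomp M n \<Longrightarrow> \<ominus>\<^bsub>M\<^esub> x \<in> mcomp M n"
  by (simp add: a_inv_def additive_subgroup.a_subgroup comp_sub subgroup.m_inv_closed)

lemma comp_zero: "\<zero>\<^bsub>M\<^esub> \<in> mcomp M n"
  using additive_subgroup.zero_closed[OF comp_sub] .

lemma comp_smult: "p \<in> carrier R \<Longrightarrow> homog i p \<Longrightarrow> x \<in> mcomp M j \<Longrightarrow> p \<odot>\<^bsub>M\<^esub> x \<in> mcomp M (i + j)"
  using graded by (simp add: graded_module_def mem_rcomp_R)

text \<open>The radical of \<open>(X 1, Y 1)\<close> is the irrelevant ideal.\<close>

lemma torsion_iff:
  "x \<in> torsion R (irrelevant_ideal R) M \<longleftrightarrow>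
     x \<in> carrier M \<and> (\<exists>N. X N \<odot>\<^bsub>M\<^esub> x = \<zero>\<^bsub>M\<^esub> \<and> Y N \<odot>\<^bsub>M\<^esub> x = \<zero>\<^bsub>M\<^esub>)"
proof
  assume "x \<in> torsion R (irrelevant_ideal R) M"
  then show "x \<in> carrier M \<and> (\<exists>N. X N \<odot>\<^bsub>M\<^esub> x = \<zero>\<^bsub>M\<^esub> \<and> Y N \<odot>\<^bsub>M\<^esub> x = \<zero>\<^bsub>M\<^esub>)"
    unfolding torsion_def X_power[symmetric] Y_power[symmetric]
    using monomial_mem_irrelevant_ideal_power[of "(0, d)", where 'k='k]
      monomial_mem_irrelevant_ideal_power[of "(d, 0)", where 'k='k]
    by blast
next
  assume "x \<in> carrier M \<and> (\<exists>N. X N \<odot>\<^bsub>M\<^esub> x = \<zero>\<^bsub>M\<^esub> \<and> Y N \<odot>\<^bsub>M\<^esub> x = \<zero>\<^bsub>M\<^esub>)"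
  then obtain N where x: "x \<in> carrier M" and N: "X N \<odot>\<^bsub>M\<^esub> x = \<zero>\<^bsub>M\<^esub>" "Y N \<odot>\<^bsub>M\<^esub> x = \<zero>\<^bsub>M\<^esub>" by blast
  \<comment> \<open>By \<open>mem_cone_if_large\<close>, terms of degree at least
    \<open>2 * (N + L)\<close> lie in the ideal generated by \<open>X N\<close> and
    \<open>Y N\<close>, which annihilates \<open>x\<close>.\<close>
  have "p \<odot>\<^bsub>M\<^esub> x = \<zero>\<^bsub>M\<^esub>" if "p \<in> power_ideal (2 * (N + L))" for p
  proof -
    have "Poly_Mapping.keys p \<subseteq> cone N"
      using that mem_cone_if_large[of _ N] unfolding power_ideal_def mem_carrier_R by blast
    then obtain a b where ab: "a \<in> carrier R" "b \<in> carrier R" "p = X N * a + Y N * b"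
      using cone_decomposition by blast
    have "p \<odot>\<^bsub>M\<^esub> x = a \<odot>\<^bsub>M\<^esub> (X N \<odot>\<^bsub>M\<^esub> x) \<oplus>\<^bsub>M\<^esub> b \<odot>\<^bsub>M\<^esub> (Y N \<odot>\<^bsub>M\<^esub> x)"
      unfolding ab(3) using ab x by (simp add: smult(3) smult(4)[symmetric] mult.commute)
    then show ?thesis using ab x by (simp add: N smult_trivial(3))
  qed
  then show "x \<in> torsion R (irrelevant_ideal R) M"
    using x irrelevant_ideal_power_subset[where 'k='k] unfolding torsion_def by blast
qed

lemma torsion_mono:
  assumes "x \<in> carrier M" "X N \<odot>\<^bsub>M\<^esub> x = \<zero>\<^bsub>M\<^esub>" "Y N \<odot>\<^bsub>M\<^esub> x = \<zero>\<^bsub>M\<^esub>" "N \<le> N'"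
  shows "X N' \<odot>\<^bsub>M\<^esub> x = \<zero>\<^bsub>M\<^esub>" "Y N' \<odot>\<^bsub>M\<^esub> x = \<zero>\<^bsub>M\<^esub>"
  using assms smult(4)[of "X (N' - N)" x "X N"] smult(4)[of "Y (N' - N)" x "Y N"] smult_trivial(3)
  by (simp_all flip: X_add Y_add)

lemma torsion_add:
  assumes "x \<in> torsion R (irrelevant_ideal R) M" "y \<in> torsion R (irrelevant_ideal R) M"
  shows "x \<oplus>\<^bsub>M\<^esub> y \<in> torsion R (irrelevant_ideal R) M"
proof -
  obtain N1 N2 where N: "x \<in> carrier M" "X N1 \<odot>\<^bsub>M\<^esub> x = \<zero>\<^bsub>M\<^esub>" "Y N1 \<odot>\<^bsub>M\<^esub> x = \<zero>\<^bsub>M\<^esub>"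
    "y \<in> carrier M" "X N2 \<odot>\<^bsub>M\<^esub> y = \<zero>\<^bsub>M\<^esub>" "Y N2 \<odot>\<^bsub>M\<^esub> y = \<zero>\<^bsub>M\<^esub>"
    using assms unfolding torsion_iff by blast
  then have "X (max N1 N2) \<odot>\<^bsub>M\<^esub> (x \<oplus>\<^bsub>M\<^esub> y) = \<zero>\<^bsub>M\<^esub>" "Y (max N1 N2) \<odot>\<^bsub>M\<^esub> (x \<oplus>\<^bsub>M\<^esub> y) = \<zero>\<^bsub>M\<^esub>"
    using torsion_mono[of x N1 "max N1 N2"] torsion_mono[of y N2 "max N1 N2"] by (simp_all add: smult(2))
  then show ?thesis using N torsion_iff by blast
qed

lemma torsion_uminus:
  assumes "x \<in> torsion R (irrelevant_ideal R) M"
  shows "\<ominus>\<^bsub>M\<^esub> x \<in> torsion R (irrelevant_ideal R) M"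
proof -
  obtain N where N: "x \<in> carrier M" "X N \<odot>\<^bsub>M\<^esub> x = \<zero>\<^bsub>M\<^esub>" "Y N \<odot>\<^bsub>M\<^esub> x = \<zero>\<^bsub>M\<^esub>"
    using assms unfolding torsion_iff by blast
  then have "X N \<odot>\<^bsub>M\<^esub> (\<ominus>\<^bsub>M\<^esub> x) = \<zero>\<^bsub>M\<^esub>" "Y N \<odot>\<^bsub>M\<^esub> (\<ominus>\<^bsub>M\<^esub> x) = \<zero>\<^bsub>M\<^esub>"
    by (simp_all add: smult(5) M.add.inv_one)
  then show ?thesis using N torsion_iff by blast
qed

text \<open>If \<open>Y N * f = X N * g\<close> then \<open>f / X N = g / Y N\<close> is an element of an injective module.\<close>

lemma common_quotient:
  assumes inj: "graded_injective R M"
    and f: "f \<in> mcomp M (n + int N)" and g: "g \<in> mcomp M (n + int N)"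
    and fg: "Y N \<odot>\<^bsub>M\<^esub> f = X N \<odot>\<^bsub>M\<^esub> g"
  obtains h where "h \<in> mcomp M n"
    "X (N + L) \<odot>\<^bsub>M\<^esub> h = X L \<odot>\<^bsub>M\<^esub> f" "Y (N + L) \<odot>\<^bsub>M\<^esub> h = Y L \<odot>\<^bsub>M\<^esub> g"
proof -
  let ?N = "N + L"
  \<comment> \<open>The extra factors \<open>X L\<close> and \<open>Y L\<close> compensate for
    syzygies of the parameters whose coefficient \<open>c\<close> is not in
    \<open>R\<close>.\<close>
  define f' where "f' = X L \<odot>\<^bsub>M\<^esub> f"
  define g' where "g' = Y L \<odot>\<^bsub>M\<^esub> g"
  have fc: "f \<in> carrier M" "g \<in> carrier M" using f g comp_closed by blast+
  have f': "f' \<in> mcomp M (n + int ?N)" "g' \<in> mcomp M (n + int ?N)"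
    using comp_smult[OF X_carrier homog_X f, of L] comp_smult[OF Y_carrier homog_Y g, of L]
    by (simp_all add: f'_def g'_def algebra_simps)
  then have fc': "f' \<in> carrier M" "g' \<in> carrier M" using comp_closed by blast+
  \<comment> \<open>The graph of the intended homomorphism, sending \<open>X ?N\<close> to
    \<open>f'\<close> and \<open>Y ?N\<close> to \<open>g'\<close>; \<open>\<phi>\<close> is read
    off from it once single-valuedness is known.\<close>
  define rel where "rel p e \<longleftrightarrow> (\<exists>a\<in>carrier R. \<exists>b\<in>carrier R. p = X ?N * a + Y ?N * b \<and>
      e = a \<odot>\<^bsub>M\<^esub> f' \<oplus>\<^bsub>M\<^esub> b \<odot>\<^bsub>M\<^esub> g')" for p e
  define \<phi> where "\<phi> p = (THE e. rel p e)" for p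
  have uniq: "e = e'" if "rel p e" "rel p e'" for p e e'
  proof -
    obtain a b where ab: "a \<in> carrier R" "b \<in> carrier R" "p = X ?N * a + Y ?N * b"
      "e = a \<odot>\<^bsub>M\<^esub> f' \<oplus>\<^bsub>M\<^esub> b \<odot>\<^bsub>M\<^esub> g'"
      using \<open>rel p e\<close> unfolding rel_def by blast
    obtain a' b' where ab': "a' \<in> carrier R" "b' \<in> carrier R" "p = X ?N * a' + Y ?N * b'"
      "e' = a' \<odot>\<^bsub>M\<^esub> f' \<oplus>\<^bsub>M\<^esub> b' \<odot>\<^bsub>M\<^esub> g'"
      using \<open>rel p e'\<close> unfolding rel_def by blast
    \<comment> \<open>Two representations of \<open>p\<close> differ by a syzygy of
      \<open>X ?N\<close> and \<open>Y ?N\<close>.\<close>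
    have "X ?N * a + Y ?N * b = X ?N * a' + Y ?N * b'" using ab(3) ab'(3) by simp
    then have "(X ?N * a + Y ?N * b) - (X ?N * a' + Y ?N * b)
        = (X ?N * a' + Y ?N * b') - (X ?N * a' + Y ?N * b)" by (rule arg_cong)
    then have "X ?N * (a - a') = Y ?N * (b' - b)" by (simp add: right_diff_distrib)
    then obtain c where c: "a - a' = Y ?N * c" "b' - b = X ?N * c" "X L * c \<in> carrier R" "Y L * c \<in> carrier R"
      using syzygy[of "a - a'" "b' - b"] ab ab' by auto
    have cR: "Y ?N * c \<in> carrier R" "X ?N * c \<in> carrier R" using ab ab' by (simp_all flip: c(1,2))
    \<comment> \<open>Since \<open>c\<close> need not act on \<open>M\<close>, the factor
      \<open>X L\<close> is moved from \<open>f'\<close> to \<open>c\<close>. After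
      \<open>Y N * f\<close> has been replaced by \<open>X N * g\<close>, it joins
      \<open>X N\<close> to form \<open>X ?N\<close>.\<close>
    have "(Y ?N * c) \<odot>\<^bsub>M\<^esub> f' = (Y ?N * c * X L) \<odot>\<^bsub>M\<^esub> f"
      using cR fc by (simp add: f'_def smult(4))
    also have "Y ?N * c * X L = (X L * c) * Y L * Y N" unfolding Y_add by (simp only: mult_ac)
    also have "\<dots> \<odot>\<^bsub>M\<^esub> f = ((X L * c) * Y L) \<odot>\<^bsub>M\<^esub> (Y N \<odot>\<^bsub>M\<^esub> f)"
      using c fc by (intro smult(4)) auto
    also have "\<dots> = ((X L * c) * Y L * X N) \<odot>\<^bsub>M\<^esub> g"
      unfolding fg using c fc by (intro smult(4)[symmetric]) auto
    also have "(X L * c) * Y L * X N = X ?N * c * Y L" unfolding X_add by (simp only: mult_ac)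
    also have "\<dots> \<odot>\<^bsub>M\<^esub> g = (X ?N * c) \<odot>\<^bsub>M\<^esub> g'"
      using cR fc by (simp add: g'_def smult(4))
    finally have koszul: "(Y ?N * c) \<odot>\<^bsub>M\<^esub> f' = (X ?N * c) \<odot>\<^bsub>M\<^esub> g'" .
    have "a = a' + Y ?N * c" "b' = b + X ?N * c" using c(1,2) by (metis add.commute diff_add_cancel)+
    then have "a \<odot>\<^bsub>M\<^esub> f' = a' \<odot>\<^bsub>M\<^esub> f' \<oplus>\<^bsub>M\<^esub> (X ?N * c) \<odot>\<^bsub>M\<^esub> g'"
      "b' \<odot>\<^bsub>M\<^esub> g' = b \<odot>\<^bsub>M\<^esub> g' \<oplus>\<^bsub>M\<^esub> (X ?N * c) \<odot>\<^bsub>M\<^esub> g'"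
      using smult(3)[OF ab'(1) fc'(1) cR(1)] smult(3)[OF ab(2) fc'(2) cR(2)] koszul by simp_all
    then show ?thesis
      using ab ab' fc' cR by (simp add: M.a_ac smult(1))
  qed
  have \<phi>: "\<phi> p = e" if "rel p e" for p e
    unfolding \<phi>_def using that uniq by blast
  have rel_ex: "\<exists>e. rel p e \<and> e \<in> carrier M \<and> (\<forall>j. homog (j - n) p \<longrightarrow> e \<in> mcomp M j)"
    if keys: "Poly_Mapping.keys p \<subseteq> cone ?N" for p
  proof -
    obtain a b where ab: "a \<in> carrier R" "b \<in> carrier R" "p = X ?N * a + Y ?N * b"
      and hom: "\<And>s. homog s p \<Longrightarrow> homog (s - int ?N) a \<and> homog (s - int ?N) b"
      using cone_decomposition[OF keys] by blast
    have "a \<odot>\<^bsub>M\<^esub> f' \<oplus>\<^bsub>M\<^esub> b \<odot>\<^bsub>M\<^esub> g' \<in> mcomp M j" if "homog (j - n) p" for j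
    proof (rule comp_add)
      show "a \<odot>\<^bsub>M\<^esub> f' \<in> mcomp M j" "b \<odot>\<^bsub>M\<^esub> g' \<in> mcomp M j"
        using comp_smult[OF ab(1) conjunct1[OF hom[OF that]] f'(1)]
          comp_smult[OF ab(2) conjunct2[OF hom[OF that]] f'(2)] by simp_all
    qed
    then show ?thesis using ab fc' unfolding rel_def by (blast intro: smult(1) M.a_closed)
  qed
  \<comment> \<open>The shift by \<open>n\<close> gives \<open>X ?N\<close> and \<open>Y ?N\<close>
    the degree \<open>n + ?N\<close> of \<open>f'\<close> and \<open>g'\<close>, so that
    \<open>h\<close> gets degree \<open>n\<close>.\<close>
  have "graded_hom R (monomial_ideal (cone ?N) n) M \<phi>"
    unfolding graded_hom_def
  proof (intro conjI allI ballI)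
    show "\<phi> \<in> carrier (monomial_ideal (cone ?N) n) \<rightarrow> carrier M"
      using rel_ex \<phi> by fastforce
  next
    fix p q :: "(nat \<times> nat) \<Rightarrow>\<^sub>0 'k"
    assume "p \<in> carrier (monomial_ideal (cone ?N) n)" "q \<in> carrier (monomial_ideal (cone ?N) n)"
    then obtain e e' where e: "rel p e" "rel q e'" using rel_ex by fastforce
    then obtain a b a' b' where ab: "a \<in> carrier R" "b \<in> carrier R" "p = X ?N * a + Y ?N * b"
      "e = a \<odot>\<^bsub>M\<^esub> f' \<oplus>\<^bsub>M\<^esub> b \<odot>\<^bsub>M\<^esub> g'" "a' \<in> carrier R" "b' \<in> carrier R" "q = X ?N * a' + Y ?N * b'"
      "e' = a' \<odot>\<^bsub>M\<^esub> f' \<oplus>\<^bsub>M\<^esub> b' \<odot>\<^bsub>M\<^esub> g'"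
      unfolding rel_def by blast
    have "rel (p + q) (e \<oplus>\<^bsub>M\<^esub> e')"
      unfolding rel_def
    proof (intro bexI conjI)
      show "p + q = X ?N * (a + a') + Y ?N * (b + b')" using ab by (simp add: algebra_simps)
      show "e \<oplus>\<^bsub>M\<^esub> e' = (a + a') \<odot>\<^bsub>M\<^esub> f' \<oplus>\<^bsub>M\<^esub> (b + b') \<odot>\<^bsub>M\<^esub> g'"
        using ab fc' by (simp add: smult(1,3) M.a_ac)
    qed (use ab in auto)
    then show "\<phi> (p \<oplus>\<^bsub>monomial_ideal (cone ?N) n\<^esub> q) = \<phi> p \<oplus>\<^bsub>M\<^esub> \<phi> q" using \<phi> e by simp
  next
    fix r p :: "(nat \<times> nat) \<Rightarrow>\<^sub>0 'k" assume r: "r \<in> carrier R" and "p \<in> carrier (monomial_ideal (cone ?N) n)"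
    then obtain e where e: "rel p e" using rel_ex by fastforce
    then obtain a b where ab: "a \<in> carrier R" "b \<in> carrier R" "p = X ?N * a + Y ?N * b"
      "e = a \<odot>\<^bsub>M\<^esub> f' \<oplus>\<^bsub>M\<^esub> b \<odot>\<^bsub>M\<^esub> g'" unfolding rel_def by blast
    have "rel (r * p) (r \<odot>\<^bsub>M\<^esub> e)"
      unfolding rel_def
    proof (intro bexI conjI)
      show "r * p = X ?N * (r * a) + Y ?N * (r * b)" using ab by (simp add: algebra_simps)
      show "r \<odot>\<^bsub>M\<^esub> e = (r * a) \<odot>\<^bsub>M\<^esub> f' \<oplus>\<^bsub>M\<^esub> (r * b) \<odot>\<^bsub>M\<^esub> g'"
        using ab r fc' by (simp add: smult(1,2,4))
    qed (use ab r in auto)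
    then show "\<phi> (r \<odot>\<^bsub>monomial_ideal (cone ?N) n\<^esub> p) = r \<odot>\<^bsub>M\<^esub> \<phi> p" using \<phi> e by simp
  next
    fix j
    show "\<phi> ` mcomp (monomial_ideal (cone ?N) n) j \<subseteq> mcomp M j"
      using rel_ex \<phi> by fastforce
  qed
  then obtain h where h: "h \<in> mcomp M n" "\<And>p. Poly_Mapping.keys p \<subseteq> cone ?N \<Longrightarrow> p \<odot>\<^bsub>M\<^esub> h = \<phi> p"
    using extend_from_ideal[OF inj cone_subset cone_add] by metis
  have "rel (X ?N) f'"
    unfolding rel_def using fc' by (intro bexI[of _ 1] bexI[of _ 0]) (simp_all add: smult_trivial)
  moreover have "rel (Y ?N) g'"
    unfolding rel_def using fc' by (intro bexI[of _ 0] bexI[of _ 1]) (simp_all add: smult_trivial)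
  moreover have "(0, ?N * d) \<in> cone ?N" "(?N * d, 0) \<in> cone ?N"
    using S_zero unfolding cone_def by (force simp: image_iff prod_eq_iff)+
  ultimately have "X ?N \<odot>\<^bsub>M\<^esub> h = f'" "Y ?N \<odot>\<^bsub>M\<^esub> h = g'"
    using h(2) \<phi> by simp_all
  with h(1) that show ?thesis unfolding f'_def g'_def by blast
qed

end

section \<open>Vanishing of the second local cohomology\<close>

context conductor_monoid
begin

lemma graded_module_over_if_injective:
  fixes M :: "((nat \<times> nat) \<Rightarrow>\<^sub>0 'k::field, 'e) gmodule"
  assumes "graded_injective R M"
  shows "graded_module_over S d L S1 S2 M"
  using assms conductor_monoid_axioms
  by (simp add: graded_module_over_def graded_module_over_axioms_def graded_injective_def)

text \<open>By \<open>cover\<close>, the quotient of \<open>R\<^sub>X\<^sub>Y\<close> by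
  \<open>R\<^sub>X + R\<^sub>Y\<close> vanishes in degree \<open>n\<close>. The chase transfers this
  to the given resolution without comparing whole complexes.\<close>

lemma cocycle_imp_coboundary:
  fixes E :: "nat \<Rightarrow> ((nat \<times> nat) \<Rightarrow>\<^sub>0 'k::field, 'e) gmodule"
  assumes res: "graded_injective_resolution R (regular_gmodule R) E \<epsilon> \<delta>"
    and cover: "\<And>x y :: int. x + y = n * int d \<Longrightarrow> x \<in> int ` S1 \<or> y \<in> int ` S2"
    and z: "z \<in> torsion R (irrelevant_ideal R) (E 2)" "z \<in> mcomp (E 2) n" "\<delta> 2 z = \<zero>\<^bsub>E 3\<^esub>"
  shows "\<exists>w\<in>torsion R (irrelevant_ideal R) (E 1) \<inter> mcomp (E 1) n. \<delta> 1 w = z"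
proof -
  have inj: "graded_injective R (E i)" for i
    using res by (simp add: graded_injective_resolution_def)
  interpret E0: graded_module_over S d L S1 S2 "E 0" by (rule graded_module_over_if_injective[OF inj])
  interpret E1: graded_module_over S d L S1 S2 "E 1" by (rule graded_module_over_if_injective[OF inj])
  interpret E2: graded_module_over S d L S1 S2 "E 2" by (rule graded_module_over_if_injective[OF inj])
  let ?R = "regular_gmodule R :: ((nat \<times> nat) \<Rightarrow>\<^sub>0 'k, (nat \<times> nat) \<Rightarrow>\<^sub>0 'k) gmodule"
  have hom: "graded_hom R ?R (E 0) \<epsilon>" "graded_hom R (E 0) (E 1) (\<delta> 0)" "graded_hom R (E 1) (E 2) (\<delta> 1)"
    using res by (simp_all add: graded_injective_resolution_def numeral_2_eq_2)
  have gR: "graded_module R ?R" using res by (simp add: graded_injective_resolution_def)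
  have exact: "\<epsilon> ` carrier ?R = {x \<in> carrier (E 0). \<delta> 0 x = \<zero>\<^bsub>E 1\<^esub>}"
    "\<delta> 0 ` carrier (E 0) = {x \<in> carrier (E 1). \<delta> 1 x = \<zero>\<^bsub>E 2\<^esub>}"
    "\<delta> 1 ` carrier (E 1) = {x \<in> carrier (E 2). \<delta> 2 x = \<zero>\<^bsub>E 3\<^esub>}"
    using res unfolding graded_injective_resolution_def
    by (simp_all add: numeral_2_eq_2 numeral_3_eq_3)
  have carR: "carrier ?R = carrier R" by (simp add: regular_gmodule_def)
  have \<epsilon>: "\<epsilon> p \<in> carrier (E 0)" "\<delta> 0 (\<epsilon> p) = \<zero>\<^bsub>E 1\<^esub>" if "p \<in> carrier R" for p
    using exact(1) that unfolding carR by blast+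
  have \<epsilon>_add: "\<epsilon> (p + q) = \<epsilon> p \<oplus>\<^bsub>E 0\<^esub> \<epsilon> q" and \<epsilon>_smult: "\<epsilon> (p * q) = p \<odot>\<^bsub>E 0\<^esub> \<epsilon> q"
    if "p \<in> carrier R" "q \<in> carrier R" for p q
    using hom(1) that unfolding graded_hom_def by (simp_all add: regular_gmodule_def)
  have \<epsilon>_comp: "\<epsilon> p \<in> mcomp (E 0) m" if "p \<in> carrier R" "homog m p" for p m
  proof -
    have "p \<in> mcomp ?R m" using that mem_rcomp_R[of p m] by (simp add: regular_gmodule_def)
    then show ?thesis using hom(1) unfolding graded_hom_def by blast
  qed
  have \<delta>0_closed: "\<delta> 0 x \<in> carrier (E 1)" and \<delta>\<delta>: "\<delta> 1 (\<delta> 0 x) = \<zero>\<^bsub>E 2\<^esub>"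
    and \<delta>0_smult: "p \<in> carrier R \<Longrightarrow> \<delta> 0 (p \<odot>\<^bsub>E 0\<^esub> x) = p \<odot>\<^bsub>E 1\<^esub> \<delta> 0 x"
    and \<delta>0_add: "y \<in> carrier (E 0) \<Longrightarrow> \<delta> 0 (x \<oplus>\<^bsub>E 0\<^esub> y) = \<delta> 0 x \<oplus>\<^bsub>E 1\<^esub> \<delta> 0 y"
    if "x \<in> carrier (E 0)" for p x y
    using hom(2) exact(2) that unfolding graded_hom_def by blast+
  have \<delta>1_smult: "p \<in> carrier R \<Longrightarrow> \<delta> 1 (p \<odot>\<^bsub>E 1\<^esub> x) = p \<odot>\<^bsub>E 2\<^esub> \<delta> 1 x"
    and \<delta>1_add: "y \<in> carrier (E 1) \<Longrightarrow> \<delta> 1 (x \<oplus>\<^bsub>E 1\<^esub> y) = \<delta> 1 x \<oplus>\<^bsub>E 2\<^esub> \<delta> 1 y"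
    if "x \<in> carrier (E 1)" for p x y
    using hom(3) that unfolding graded_hom_def by blast+
  \<comment> \<open>Keeps \<open>E 1\<close> and \<open>\<delta> 1\<close> from being rewritten with
    \<open>Suc 0\<close>.\<close>
  note One_nat_def [simp del]
  have lift0: "\<exists>f\<in>mcomp (E 0) m. \<delta> 0 f = x" if "x \<in> mcomp (E 1) m" "\<delta> 1 x = \<zero>\<^bsub>E 2\<^esub>" for x m
  proof -
    have "x \<in> \<delta> 0 ` carrier (E 0)" using that E1.comp_closed exact(2) by blast
    then show ?thesis
      using graded_hom_homogeneous_preimage[OF E0.graded E1.graded hom(2)] that by blast
  qed

  obtain N where N: "z \<in> carrier (E 2)" "X N \<odot>\<^bsub>E 2\<^esub> z = \<zero>\<^bsub>E 2\<^esub>" "Y N \<odot>\<^bsub>E 2\<^esub> z = \<zero>\<^bsub>E 2\<^esub>"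
    using z(1) E2.torsion_iff by blast
  \<comment> \<open>Exactness yields a preimage \<open>e\<close> that need not be torsion; the
    remaining proof corrects it by an element of the image of \<open>\<delta> 0\<close>.\<close>
  have "z \<in> \<delta> 1 ` carrier (E 1)" using N z exact(3) by blast
  then obtain e where e: "e \<in> mcomp (E 1) n" "\<delta> 1 e = z"
    using graded_hom_homogeneous_preimage[OF E1.graded E2.graded hom(3)] z by blast
  have ec: "e \<in> carrier (E 1)" using e E1.comp_closed by blast
  have "X N \<odot>\<^bsub>E 1\<^esub> e \<in> mcomp (E 1) (n + int N)" "Y N \<odot>\<^bsub>E 1\<^esub> e \<in> mcomp (E 1) (n + int N)"
    using E1.comp_smult[OF X_carrier homog_X e(1), of N] E1.comp_smult[OF Y_carrier homog_Y e(1), of N]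
    by (simp_all add: add.commute)
  \<comment> \<open>\<open>X N\<close> and \<open>Y N\<close> annihilate \<open>z\<close>, so the
    multiples of \<open>e\<close> are cycles and lift to \<open>E 0\<close>.\<close>
  moreover have "\<delta> 1 (X N \<odot>\<^bsub>E 1\<^esub> e) = \<zero>\<^bsub>E 2\<^esub>" "\<delta> 1 (Y N \<odot>\<^bsub>E 1\<^esub> e) = \<zero>\<^bsub>E 2\<^esub>"
    using \<delta>1_smult[OF ec X_carrier] \<delta>1_smult[OF ec Y_carrier] N e by simp_all
  ultimately obtain f g where f: "f \<in> mcomp (E 0) (n + int N)" "\<delta> 0 f = X N \<odot>\<^bsub>E 1\<^esub> e"
    and g: "g \<in> mcomp (E 0) (n + int N)" "\<delta> 0 g = Y N \<odot>\<^bsub>E 1\<^esub> e"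
    using lift0 by meson
  have fg: "f \<in> carrier (E 0)" "g \<in> carrier (E 0)" using f g E0.comp_closed by blast+

  \<comment> \<open>The obstruction to \<open>f / X N = g / Y N\<close>. It is killed by
    \<open>\<delta> 0\<close>, hence comes from an element \<open>r\<close> of
    \<open>R\<close>.\<close>
  define D where "D = Y N \<odot>\<^bsub>E 0\<^esub> f \<oplus>\<^bsub>E 0\<^esub> (- X N) \<odot>\<^bsub>E 0\<^esub> g"
  have "Y N \<odot>\<^bsub>E 0\<^esub> f \<in> mcomp (E 0) (n + 2 * int N)" "(- X N) \<odot>\<^bsub>E 0\<^esub> g \<in> mcomp (E 0) (n + 2 * int N)"
    using E0.comp_smult[OF Y_carrier homog_Y f(1), of N]
      E0.comp_smult[OF carrier_R(4)[OF X_carrier] homog_uminus[OF homog_X] g(1), of N]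
    by (simp_all add: algebra_simps)
  then have D: "D \<in> mcomp (E 0) (n + 2 * int N)" unfolding D_def by (rule E0.comp_add)
  have "\<delta> 0 D = Y N \<odot>\<^bsub>E 1\<^esub> (X N \<odot>\<^bsub>E 1\<^esub> e) \<oplus>\<^bsub>E 1\<^esub> (- X N) \<odot>\<^bsub>E 1\<^esub> (Y N \<odot>\<^bsub>E 1\<^esub> e)"
    unfolding D_def using fg f(2) g(2) by (simp add: \<delta>0_smult \<delta>0_add E0.smult(1))
  also have "\<dots> = (Y N * X N + (- X N) * Y N) \<odot>\<^bsub>E 1\<^esub> e"
    using ec by (simp only: E1.smult carrier_R X_carrier Y_carrier)
  also have "\<dots> = \<zero>\<^bsub>E 1\<^esub>" using ec by (simp add: E1.smult_trivial mult.commute)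
  finally have "D \<in> \<epsilon> ` carrier ?R" using exact(1) D E0.comp_closed by blast
  then obtain r where "r \<in> mcomp ?R (n + 2 * int N)" "\<epsilon> r = D"
    using graded_hom_homogeneous_preimage[OF gR E0.graded hom(1)] D by blast
  then have r: "r \<in> carrier R" "homog (n + 2 * int N) r" and \<epsilon>r: "\<epsilon> r = D"
    using mem_rcomp_R[of r] by (simp_all add: regular_gmodule_def)
  have Yf: "Y N \<odot>\<^bsub>E 0\<^esub> f = X N \<odot>\<^bsub>E 0\<^esub> g \<oplus>\<^bsub>E 0\<^esub> \<epsilon> r"
  proof -
    have "X N \<odot>\<^bsub>E 0\<^esub> g \<oplus>\<^bsub>E 0\<^esub> \<epsilon> r
        = Y N \<odot>\<^bsub>E 0\<^esub> f \<oplus>\<^bsub>E 0\<^esub> (X N \<odot>\<^bsub>E 0\<^esub> g \<oplus>\<^bsub>E 0\<^esub> (- X N) \<odot>\<^bsub>E 0\<^esub> g)"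
      unfolding \<epsilon>r D_def using fg by (simp add: E0.M.a_ac E0.smult(1))
    also have "X N \<odot>\<^bsub>E 0\<^esub> g \<oplus>\<^bsub>E 0\<^esub> (- X N) \<odot>\<^bsub>E 0\<^esub> g = (X N + - X N) \<odot>\<^bsub>E 0\<^esub> g"
      by (rule E0.smult(3)[symmetric]) (simp_all add: fg)
    also have "\<dots> = \<zero>\<^bsub>E 0\<^esub>" using fg by (simp add: E0.smult_trivial(2))
    finally show ?thesis using fg by (simp add: E0.smult(1))
  qed
  obtain r1 r2 p1 p2 where rp: "r1 \<in> carrier R" "r2 \<in> carrier R" "r = r1 + r2"
    "p1 \<in> carrier R" "p2 \<in> carrier R" "X L * r1 = Y N * p1" "Y L * r2 = X N * p2"
    "homog (n + int (N + L)) p1" "homog (n + int (N + L)) p2"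
    using cech_class_zero[OF r cover] by blast

  let ?N = "N + L"
  \<comment> \<open>The splitting of \<open>r\<close> gives
    \<open>X L * Y L * r = Y ?N * p1 + X ?N * p2\<close>, so these corrections remove the
    obstruction. Coming from \<open>R\<close>, they do not affect the images under
    \<open>\<delta> 0\<close>.\<close>
  define f' where "f' = X L \<odot>\<^bsub>E 0\<^esub> f \<oplus>\<^bsub>E 0\<^esub> \<epsilon> (- p1)"
  define g' where "g' = Y L \<odot>\<^bsub>E 0\<^esub> g \<oplus>\<^bsub>E 0\<^esub> \<epsilon> p2"
  have "X L \<odot>\<^bsub>E 0\<^esub> f \<in> mcomp (E 0) (n + int ?N)" "Y L \<odot>\<^bsub>E 0\<^esub> g \<in> mcomp (E 0) (n + int ?N)"
    using E0.comp_smult[OF X_carrier homog_X f(1), of L] E0.comp_smult[OF Y_carrier homog_Y g(1), of L]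
    by (simp_all add: algebra_simps)
  then have f': "f' \<in> mcomp (E 0) (n + int ?N)" and g': "g' \<in> mcomp (E 0) (n + int ?N)"
    unfolding f'_def g'_def
    by (auto intro!: E0.comp_add \<epsilon>_comp homog_uminus rp carrier_R(4) simp del: of_nat_add)
  have \<delta>f'g': "\<delta> 0 f' = X L \<odot>\<^bsub>E 1\<^esub> (X N \<odot>\<^bsub>E 1\<^esub> e)" "\<delta> 0 g' = Y L \<odot>\<^bsub>E 1\<^esub> (Y N \<odot>\<^bsub>E 1\<^esub> e)"
    unfolding f'_def g'_def using fg f(2) g(2) rp ec by (simp_all add: \<delta>0_smult \<delta>0_add \<epsilon> E0.smult(1) E1.smult(1))
  have \<delta>f': "\<delta> 0 f' = X ?N \<odot>\<^bsub>E 1\<^esub> e" "\<delta> 0 g' = Y ?N \<odot>\<^bsub>E 1\<^esub> e"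
  proof -
    have "X ?N = X L * (X N :: (nat \<times> nat) \<Rightarrow>\<^sub>0 'k)" "Y ?N = Y L * (Y N :: (nat \<times> nat) \<Rightarrow>\<^sub>0 'k)"
      unfolding X_add Y_add by (simp_all only: mult.commute)
    then show "\<delta> 0 f' = X ?N \<odot>\<^bsub>E 1\<^esub> e" "\<delta> 0 g' = Y ?N \<odot>\<^bsub>E 1\<^esub> e"
      using \<delta>f'g' ec by (simp_all only: E1.smult(4) X_carrier Y_carrier)
  qed
  have "Y ?N \<odot>\<^bsub>E 0\<^esub> f' = X ?N \<odot>\<^bsub>E 0\<^esub> g'"
  proof -
    have "Y ?N \<odot>\<^bsub>E 0\<^esub> f' = Y ?N \<odot>\<^bsub>E 0\<^esub> (X L \<odot>\<^bsub>E 0\<^esub> f) \<oplus>\<^bsub>E 0\<^esub> Y ?N \<odot>\<^bsub>E 0\<^esub> \<epsilon> (- p1)"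
      unfolding f'_def using fg rp by (intro E0.smult(2)) (simp_all add: E0.smult(1) \<epsilon>)
    also have "Y ?N \<odot>\<^bsub>E 0\<^esub> (X L \<odot>\<^bsub>E 0\<^esub> f) = (Y L * X L) \<odot>\<^bsub>E 0\<^esub> (Y N \<odot>\<^bsub>E 0\<^esub> f)"
    proof -
      have "Y ?N * X L = Y L * X L * (Y N :: (nat \<times> nat) \<Rightarrow>\<^sub>0 'k)" unfolding Y_add by (simp only: mult_ac)
      then show ?thesis
        using E0.smult(4)[of "Y ?N" f "X L"] E0.smult(4)[of "Y L * X L" f "Y N"] fg by simp
    qed
    also have "\<dots> = (Y L * X L) \<odot>\<^bsub>E 0\<^esub> (X N \<odot>\<^bsub>E 0\<^esub> g) \<oplus>\<^bsub>E 0\<^esub> \<epsilon> (Y L * X L * r)"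
      unfolding Yf using fg r by (simp only: E0.smult(1,2) \<epsilon> \<epsilon>_smult carrier_R X_carrier Y_carrier)
    also have "(Y L * X L) \<odot>\<^bsub>E 0\<^esub> (X N \<odot>\<^bsub>E 0\<^esub> g) = X ?N \<odot>\<^bsub>E 0\<^esub> (Y L \<odot>\<^bsub>E 0\<^esub> g)"
    proof -
      have "Y L * X L * X N = X ?N * (Y L :: (nat \<times> nat) \<Rightarrow>\<^sub>0 'k)" unfolding X_add by (simp only: mult_ac)
      then show ?thesis
        using E0.smult(4)[of "X ?N" g "Y L"] E0.smult(4)[of "Y L * X L" g "X N"] fg by simp
    qed
    also have "Y ?N \<odot>\<^bsub>E 0\<^esub> \<epsilon> (- p1) = \<epsilon> (Y ?N * - p1)"
      by (rule \<epsilon>_smult[symmetric]) (simp_all add: rp)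
    also have "X ?N \<odot>\<^bsub>E 0\<^esub> (Y L \<odot>\<^bsub>E 0\<^esub> g) \<oplus>\<^bsub>E 0\<^esub> \<epsilon> (Y L * X L * r) \<oplus>\<^bsub>E 0\<^esub> \<epsilon> (Y ?N * - p1)
        = X ?N \<odot>\<^bsub>E 0\<^esub> (Y L \<odot>\<^bsub>E 0\<^esub> g) \<oplus>\<^bsub>E 0\<^esub> \<epsilon> (Y L * X L * r + Y ?N * - p1)"
    proof -
      have "Y L * X L * r \<in> carrier R" "Y ?N * - p1 \<in> carrier R" using r rp by (simp_all only: carrier_R X_carrier Y_carrier)
      then show ?thesis using fg by (simp only: \<epsilon>_add E0.M.a_assoc E0.smult(1) \<epsilon>(1) Y_carrier X_carrier)
    qed
    also have "Y L * X L * r + Y ?N * - p1 = X ?N * p2"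
    proof -
      have "Y L * X L * r + Y ?N * - p1 = Y L * (X L * r1) + X L * (Y L * r2) - Y L * (Y N * p1)"
        unfolding Y_add rp(3) by (simp add: algebra_simps)
      also have "\<dots> = X L * (X N * p2)" unfolding rp(6,7) by simp
      also have "\<dots> = X ?N * p2" unfolding X_add by (simp only: mult_ac)
      finally show ?thesis .
    qed
    also have "\<epsilon> (X ?N * p2) = X ?N \<odot>\<^bsub>E 0\<^esub> \<epsilon> p2"
      by (rule \<epsilon>_smult) (simp_all add: rp)
    also have "X ?N \<odot>\<^bsub>E 0\<^esub> (Y L \<odot>\<^bsub>E 0\<^esub> g) \<oplus>\<^bsub>E 0\<^esub> \<dots> = X ?N \<odot>\<^bsub>E 0\<^esub> g'"
      unfolding g'_def using fg rp by (intro E0.smult(2)[symmetric]) (simp_all add: E0.smult(1) \<epsilon>)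
    finally show ?thesis .
  qed
  \<comment> \<open>\<open>h\<close> plays the role of \<open>f' / X ?N = g' / Y ?N\<close>; the
    division raises the exponents by \<open>L\<close> once more.\<close>
  then obtain h where h: "h \<in> mcomp (E 0) n" "X (?N + L) \<odot>\<^bsub>E 0\<^esub> h = X L \<odot>\<^bsub>E 0\<^esub> f'"
    "Y (?N + L) \<odot>\<^bsub>E 0\<^esub> h = Y L \<odot>\<^bsub>E 0\<^esub> g'"
    using E0.common_quotient[OF inj f' g'] by blast
  have hc: "h \<in> carrier (E 0)" "f' \<in> carrier (E 0)" "g' \<in> carrier (E 0)"
    using h f' g' E0.comp_closed by blast+

  \<comment> \<open>High powers of the parameters act alike on \<open>e\<close> and
    \<open>\<delta> 0 h\<close>, so the difference is torsion and still maps to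
    \<open>z\<close>.\<close>
  define w where "w = e \<oplus>\<^bsub>E 1\<^esub> \<ominus>\<^bsub>E 1\<^esub> \<delta> 0 h"
  have dh: "\<delta> 0 h \<in> mcomp (E 1) n" using h(1) hom(2) unfolding graded_hom_def by blast
  then have dhc: "\<delta> 0 h \<in> carrier (E 1)" using E1.comp_closed by blast
  have wn: "w \<in> mcomp (E 1) n" unfolding w_def using e dh by (intro E1.comp_add E1.comp_uminus)
  then have wc: "w \<in> carrier (E 1)" using E1.comp_closed by blast
  have annih: "p \<odot>\<^bsub>E 1\<^esub> w = \<zero>\<^bsub>E 1\<^esub>" if "p \<in> carrier R" "p \<odot>\<^bsub>E 1\<^esub> e = \<delta> 0 (p \<odot>\<^bsub>E 0\<^esub> h)" for p
    unfolding w_def using that ec dhc hc \<delta>0_smult[OF hc(1) that(1)]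
    by (simp add: E1.smult(1,2,5) E1.M.r_neg)
  have "X (?N + L) \<odot>\<^bsub>E 1\<^esub> e = \<delta> 0 (X (?N + L) \<odot>\<^bsub>E 0\<^esub> h)"
  proof -
    have "\<delta> 0 (X (?N + L) \<odot>\<^bsub>E 0\<^esub> h) = X L \<odot>\<^bsub>E 1\<^esub> (X ?N \<odot>\<^bsub>E 1\<^esub> e)"
      unfolding h(2) \<delta>f'(1)[symmetric] using hc by (intro \<delta>0_smult) auto
    also have "\<dots> = (X L * X ?N) \<odot>\<^bsub>E 1\<^esub> e" using ec by (intro E1.smult(4)[symmetric]) auto
    also have "X L * X ?N = X (?N + L)" unfolding X_add by (simp only: mult_ac)
    finally show ?thesis by simp
  qed
  moreover have "Y (?N + L) \<odot>\<^bsub>E 1\<^esub> e = \<delta> 0 (Y (?N + L) \<odot>\<^bsub>E 0\<^esub> h)"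
  proof -
    have "\<delta> 0 (Y (?N + L) \<odot>\<^bsub>E 0\<^esub> h) = Y L \<odot>\<^bsub>E 1\<^esub> (Y ?N \<odot>\<^bsub>E 1\<^esub> e)"
      unfolding h(3) \<delta>f'(2)[symmetric] using hc by (intro \<delta>0_smult) auto
    also have "\<dots> = (Y L * Y ?N) \<odot>\<^bsub>E 1\<^esub> e" using ec by (intro E1.smult(4)[symmetric]) auto
    also have "Y L * Y ?N = Y (?N + L)" unfolding Y_add by (simp only: mult_ac)
    finally show ?thesis by simp
  qed
  ultimately have "w \<in> torsion R (irrelevant_ideal R) (E 1)"
    using annih wc E1.torsion_iff X_carrier Y_carrier by blast
  moreover have "\<delta> 1 w = z"
  proof -
    have "w \<oplus>\<^bsub>E 1\<^esub> \<delta> 0 h = e"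
      unfolding w_def using ec dhc by (simp add: E1.M.a_assoc E1.M.l_neg)
    then have "\<delta> 1 w \<oplus>\<^bsub>E 2\<^esub> \<delta> 1 (\<delta> 0 h) = z"
      using \<delta>1_add[OF wc dhc] e(2) by simp
    moreover have "\<delta> 1 (\<delta> 0 h) = \<zero>\<^bsub>E 2\<^esub>" using \<delta>\<delta>[OF hc(1)] .
    moreover have "\<delta> 1 w \<in> carrier (E 2)" using exact(3) wc by blast
    ultimately show ?thesis by simp
  qed
  ultimately show ?thesis using wn by blast
qed

text \<open>Cocycles and coboundaries form the same set, which is then the only coset and also the
  unit of the factor group.\<close>

lemma local_cohomology_trivial:
  fixes E :: "nat \<Rightarrow> ((nat \<times> nat) \<Rightarrow>\<^sub>0 'k::field, 'e) gmodule"
  assumes res: "graded_injective_resolution R (regular_gmodule R) E \<epsilon> \<delta>"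
    and cover: "\<And>x y :: int. x + y = n * int d \<Longrightarrow> x \<in> int ` S1 \<or> y \<in> int ` S2"
  defines "H \<equiv> local_cohomology R (irrelevant_ideal R) E \<delta> 2 n"
  shows "carrier H = {\<one>\<^bsub>H\<^esub>}"
proof -
  have inj: "graded_injective R (E i)" for i
    using res by (simp add: graded_injective_resolution_def)
  interpret E1: graded_module_over S d L S1 S2 "E 1" by (rule graded_module_over_if_injective[OF inj])
  interpret E2: graded_module_over S d L S1 S2 "E 2" by (rule graded_module_over_if_injective[OF inj])
  have hom: "graded_hom R (E 1) (E 2) (\<delta> 1)"
    using res by (simp add: graded_injective_resolution_def numeral_2_eq_2)
  have exact: "\<delta> 1 ` carrier (E 1) = {x \<in> carrier (E 2). \<delta> 2 x = \<zero>\<^bsub>E 3\<^esub>}"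
    using res unfolding graded_injective_resolution_def
    by (simp_all add: numeral_2_eq_2 numeral_3_eq_3)
  have \<delta>1: "\<delta> 1 x \<in> carrier (E 2)" "\<delta> 1 (p \<odot>\<^bsub>E 1\<^esub> x) = p \<odot>\<^bsub>E 2\<^esub> \<delta> 1 x"
    "\<delta> 1 (x \<oplus>\<^bsub>E 1\<^esub> y) = \<delta> 1 x \<oplus>\<^bsub>E 2\<^esub> \<delta> 1 y"
    if "p \<in> carrier R" "x \<in> carrier (E 1)" "y \<in> carrier (E 1)" for p x y
    using hom that unfolding graded_hom_def by blast+
  have \<delta>1_zero: "\<delta> 1 \<zero>\<^bsub>E 1\<^esub> = \<zero>\<^bsub>E 2\<^esub>"
    using \<delta>1(2)[OF carrier_R(5) E1.M.zero_closed E1.M.zero_closed]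
      E1.smult_trivial(2)[OF E1.M.zero_closed] E2.smult_trivial(2) \<delta>1(1)[OF carrier_R(5) E1.M.zero_closed E1.M.zero_closed]
    by simp
  note One_nat_def [simp del]
  let ?T1 = "torsion R (irrelevant_ideal R) (E 1) \<inter> mcomp (E 1) n"
  define Z where "Z = lc_cocycles R (irrelevant_ideal R) E \<delta> 2 n"
  define B where "B = lc_coboundaries R (irrelevant_ideal R) E \<delta> 2 n"
  have Z_eq: "Z = {x \<in> torsion R (irrelevant_ideal R) (E 2) \<inter> mcomp (E 2) n. \<delta> 2 x = \<zero>\<^bsub>E 3\<^esub>}"
    by (simp add: Z_def lc_cocycles_def numeral_3_eq_3 numeral_2_eq_2)
  have B_eq: "B = \<delta> 1 ` ?T1"
    by (simp add: B_def lc_coboundaries_def numeral_2_eq_2 One_nat_def)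
  have T1c: "x \<in> carrier (E 1)" if "x \<in> ?T1" for x using that E1.comp_closed by blast
  have "Z \<subseteq> B"
    unfolding Z_eq B_eq using cocycle_imp_coboundary[OF res cover] by (blast intro: sym)
  \<comment> \<open>Linearity of \<open>\<delta> 1\<close> carries annihilation by
    \<open>X N\<close> and \<open>Y N\<close> over to images, so coboundaries remain
    torsion.\<close>
  moreover have "B \<subseteq> Z"
  proof
    fix b assume "b \<in> B"
    then obtain x where x: "x \<in> ?T1" "b = \<delta> 1 x" unfolding B_eq by blast
    then obtain N where N: "x \<in> carrier (E 1)" "X N \<odot>\<^bsub>E 1\<^esub> x = \<zero>\<^bsub>E 1\<^esub>" "Y N \<odot>\<^bsub>E 1\<^esub> x = \<zero>\<^bsub>E 1\<^esub>"
      using E1.torsion_iff by blast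
    then have "X N \<odot>\<^bsub>E 2\<^esub> b = \<zero>\<^bsub>E 2\<^esub>" "Y N \<odot>\<^bsub>E 2\<^esub> b = \<zero>\<^bsub>E 2\<^esub>"
      using \<delta>1(2)[OF X_carrier, of x x N] \<delta>1(2)[OF Y_carrier, of x x N] \<delta>1_zero x(2) by simp_all
    moreover have "b \<in> carrier (E 2)" "\<delta> 2 b = \<zero>\<^bsub>E 3\<^esub>" using exact N(1) x(2) by blast+
    moreover have "b \<in> mcomp (E 2) n" using hom x unfolding graded_hom_def by blast
    ultimately show "b \<in> Z" unfolding Z_eq using E2.torsion_iff by blast
  qed
  ultimately have ZB: "Z = B" by blast
  have Zc: "x \<in> carrier (E 2)" if "x \<in> Z" for x using that E2.comp_closed unfolding Z_eq by blast
  \<comment> \<open>Closure under addition and negation makes translation by an element of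
    \<open>Z\<close> a bijection of \<open>Z\<close>, whence all cosets agree.\<close>
  have Z_add: "x \<oplus>\<^bsub>E 2\<^esub> y \<in> Z" if "x \<in> Z" "y \<in> Z" for x y
  proof -
    obtain x' y' where xy: "x' \<in> ?T1" "y' \<in> ?T1" "x = \<delta> 1 x'" "y = \<delta> 1 y'"
      using \<open>x \<in> Z\<close> \<open>y \<in> Z\<close> unfolding ZB B_eq by blast
    then have "x' \<oplus>\<^bsub>E 1\<^esub> y' \<in> ?T1" using E1.torsion_add E1.comp_add by blast
    moreover have "\<delta> 1 (x' \<oplus>\<^bsub>E 1\<^esub> y') = x \<oplus>\<^bsub>E 2\<^esub> y" using xy T1c \<delta>1(3)[OF carrier_R(5)] by blast
    ultimately show ?thesis unfolding ZB B_eq by (metis imageI)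
  qed
  have Z_uminus: "\<ominus>\<^bsub>E 2\<^esub> x \<in> Z" if "x \<in> Z" for x
  proof -
    obtain x' where x: "x' \<in> ?T1" "x = \<delta> 1 x'" using \<open>x \<in> Z\<close> unfolding ZB B_eq by blast
    then have m: "\<ominus>\<^bsub>E 1\<^esub> x' \<in> ?T1" using E1.torsion_uminus E1.comp_uminus by blast
    have "\<delta> 1 (\<ominus>\<^bsub>E 1\<^esub> x') \<oplus>\<^bsub>E 2\<^esub> x = \<delta> 1 (\<ominus>\<^bsub>E 1\<^esub> x' \<oplus>\<^bsub>E 1\<^esub> x')"
      using x m T1c \<delta>1(3)[OF carrier_R(5)] by metis
    also have "\<dots> = \<zero>\<^bsub>E 2\<^esub>" using T1c[OF x(1)] \<delta>1_zero by (simp add: E1.M.l_neg)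
    finally have "\<ominus>\<^bsub>E 2\<^esub> x = \<delta> 1 (\<ominus>\<^bsub>E 1\<^esub> x')"
      using E2.M.minus_equality Zc[OF that] \<delta>1(1)[OF carrier_R(5)] T1c[OF m] by blast
    then show ?thesis using m unfolding ZB B_eq by blast
  qed
  have "\<zero>\<^bsub>E 1\<^esub> \<in> ?T1" using E1.torsion_iff E1.smult_trivial(3) E1.comp_zero X_carrier Y_carrier by blast
  then have ne: "Z \<noteq> {}" unfolding ZB B_eq by blast
  have coset: "(\<Union>y\<in>Z. {y \<oplus>\<^bsub>E 2\<^esub> x}) = Z" if x: "x \<in> Z" for x
  proof
    show "Z \<subseteq> (\<Union>y\<in>Z. {y \<oplus>\<^bsub>E 2\<^esub> x})"
    proof
      fix y assume y: "y \<in> Z"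
      then have "y \<oplus>\<^bsub>E 2\<^esub> \<ominus>\<^bsub>E 2\<^esub> x \<in> Z" using Z_add Z_uminus x by blast
      moreover have "y = y \<oplus>\<^bsub>E 2\<^esub> \<ominus>\<^bsub>E 2\<^esub> x \<oplus>\<^bsub>E 2\<^esub> x"
        using Zc x y by (simp add: E2.M.a_assoc E2.M.l_neg)
      ultimately show "y \<in> (\<Union>y\<in>Z. {y \<oplus>\<^bsub>E 2\<^esub> x})" by blast
    qed
  qed (use Z_add x in blast)
  have "carrier H = {Z}"
    unfolding H_def local_cohomology_def Z_def[symmetric] B_def[symmetric] ZB[symmetric]
    using coset ne by (auto simp: FactGroup_def RCOSETS_def r_coset_def)
  moreover have "\<one>\<^bsub>H\<^esub> = Z"
    unfolding H_def local_cohomology_def Z_def[symmetric] B_def[symmetric] ZB[symmetric]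
    by (simp add: FactGroup_def)
  ultimately show ?thesis by simp
qed

end

section \<open>Application to projective monomial curves\<close>

text \<open>\<open>proj_monoid_conductor\<close> is applied to \<open>B\<close> and to its
  reflection, the latter followed by a swap of coordinates. As it holds for all large
  \<open>L\<close>, the maximum of both bounds serves both coordinates.\<close>

lemma proj_monoid_conductor_monoid:
  assumes B: "B \<subseteq> {..d}" "0 \<in> B" "d \<in> B" and d: "d > 0"
  shows "\<exists>L. conductor_monoid (proj_monoid d B) d L (submonoid_gen B) (submonoid_gen ((\<lambda>b. d - b) ` B))"
proof -
  let ?B' = "(\<lambda>b. d - b) ` B"
  have B': "?B' \<subseteq> {..d}" "0 \<in> ?B'" "d \<in> ?B'" using B by force+
  have "(\<lambda>b. d - b) ` ?B' = (\<lambda>b. b) ` B"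
    unfolding image_image using B(1) by (intro image_cong) auto
  then have BB: "(\<lambda>b. d - b) ` ?B' = B" by simp
  have swap: "prod.swap u \<in> proj_monoid d B" if "u \<in> proj_monoid d ?B'" for u
    using proj_monoid_swap[OF B'(1) that] unfolding BB .
  obtain L1 where L1: "\<And>L x y. L1 \<le> L \<Longrightarrow> x \<in> submonoid_gen B \<Longrightarrow> d dvd x + y \<Longrightarrow> (x, y + L * d) \<in> proj_monoid d B"
    using proj_monoid_conductor[OF B d] by blast
  obtain L2 where L2: "\<And>L x y. L2 \<le> L \<Longrightarrow> x \<in> submonoid_gen ?B' \<Longrightarrow> d dvd x + y \<Longrightarrow> (x, y + L * d) \<in> proj_monoid d ?B'"
    using proj_monoid_conductor[OF B' d] by blast
  have "conductor_monoid (proj_monoid d B) d (max L1 L2) (submonoid_gen B) (submonoid_gen ?B')"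
  proof
    show "0 \<in> proj_monoid d B" unfolding proj_monoid_def by (rule submonoid_gen.zero)
    show "u + v \<in> proj_monoid d B" if "u \<in> proj_monoid d B" "v \<in> proj_monoid d B" for u v
      using that unfolding proj_monoid_def by (rule submonoid_gen_add)
    show "(0, d) \<in> proj_monoid d B" "(d, 0) \<in> proj_monoid d B"
      unfolding proj_monoid_def using B by (force intro!: submonoid_gen_base)+
    show "d dvd fst u + snd u" "fst u \<in> submonoid_gen B" if "u \<in> proj_monoid d B" for u
      using proj_monoid_fst[OF B(1) that] by auto
    show "snd u \<in> submonoid_gen ?B'" if "u \<in> proj_monoid d B" for u
      using proj_monoid_fst[OF B'(1) proj_monoid_swap[OF B(1) that]] by simp
    show "(x, y + max L1 L2 * d) \<in> proj_monoid d B" if "x \<in> submonoid_gen B" "d dvd x + y" for x y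
      using L1[OF _ that] by simp
    show "(x + max L1 L2 * d, y) \<in> proj_monoid d B" if "y \<in> submonoid_gen ?B'" "d dvd x + y" for x y
      using swap[OF L2[of "max L1 L2" y x]] that by (simp add: add.commute)
  qed (rule d)
  then show ?thesis by blast
qed

theorem lemma4p2:
  fixes k d :: nat and a :: "nat \<Rightarrow> nat"
    and KS :: "((nat \<times> nat) \<Rightarrow>\<^sub>0 'k::field) gring"
    and E :: "nat \<Rightarrow> ((nat \<times> nat) \<Rightarrow>\<^sub>0 'k, 'e) gmodule"
    and \<epsilon> :: "((nat \<times> nat) \<Rightarrow>\<^sub>0 'k) \<Rightarrow> 'e"
    and \<delta> :: "nat \<Rightarrow> 'e \<Rightarrow> 'e"
  assumes "k \<ge> 3"
    and "a 0 = 0"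
    and "strict_mono_on {0..k} a"
    and "d = a k"
    and "Gcd (a ` {1..k}) = 1"
    and "k < d"
    and "KS = semigroup_ring d (curve_monoid k a)"
    and "graded_injective_resolution KS (regular_gmodule KS) E \<epsilon> \<delta>"
  shows "a_invariant KS (irrelevant_ideal KS) E \<delta> 2
    \<le> ereal (real_of_int
        \<lfloor>real_of_int (frobenius_number (a ` {0..k}) + frobenius_number ((\<lambda>i. d - a i) ` {0..k}))
          / real d\<rfloor>)"
proof -
  let ?B = "a ` {0..k}" and ?B' = "(\<lambda>i. d - a i) ` {0..k}"
  let ?F = "frobenius_number ?B + frobenius_number ?B'"
  have d: "d > 0" using assms(6) by simp
  have B_le: "?B \<subseteq> {..d}"
    using assms(3,4) by (auto simp: strict_mono_on_leD)
  have B0: "0 \<in> ?B" using assms(2) by force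
  have Bd: "d \<in> ?B" using assms(4) by force
  have B'_eq: "(\<lambda>b. d - b) ` ?B = ?B'" by (simp add: image_image)
  have "Gcd ?B dvd Gcd (a ` {1..k})"
    by (rule Gcd_greatest) (auto intro!: Gcd_dvd)
  then have gcd: "Gcd ?B = 1" using assms(5) by simp
  have B'd: "d \<in> ?B'" using assms(2) by force
  \<comment> \<open>\<open>d\<close> lies in \<open>?B'\<close> because \<open>a 0 = 0\<close>; a
    common divisor of \<open>d\<close> and \<open>d - b\<close> also divides
    \<open>b\<close>.\<close>
  have "Gcd ?B' dvd b" if "b \<in> ?B" for b
  proof -
    have "Gcd ?B' dvd d - b" "Gcd ?B' dvd d" using that B'd by (auto intro!: Gcd_dvd)
    moreover have "b \<le> d" using that B_le by auto
    ultimately show ?thesis by (metis dvd_diffD1)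
  qed
  then have "Gcd ?B' dvd Gcd ?B" by (rule Gcd_greatest)
  then have gcd': "Gcd ?B' = 1" using gcd by simp
  obtain L where "conductor_monoid (proj_monoid d ?B) d L (submonoid_gen ?B) (submonoid_gen ?B')"
    using proj_monoid_conductor_monoid[OF B_le B0 Bd d] unfolding B'_eq by blast
  then interpret conductor_monoid "curve_monoid k a" d L "submonoid_gen ?B" "submonoid_gen ?B'"
    using curve_monoid_eq_proj_monoid[of k a] assms(4) by simp
  have "n \<le> \<lfloor>real_of_int ?F / real d\<rfloor>"
    if n: "carrier (local_cohomology KS (irrelevant_ideal KS) E \<delta> 2 n)
      \<noteq> {\<one>\<^bsub>local_cohomology KS (irrelevant_ideal KS) E \<delta> 2 n\<^esub>}" for n
  proof (rule ccontr)
    assume "\<not> n \<le> \<lfloor>real_of_int ?F / real d\<rfloor>"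
    then have "real_of_int ?F / real d < real_of_int n" by (simp add: le_floor_iff)
    then have "real_of_int ?F < real_of_int (n * int d)" using d by (simp add: divide_less_eq)
    then have Fn: "?F < n * int d" by (simp only: of_int_less_iff)
    have "x \<in> int ` submonoid_gen ?B \<or> y \<in> int ` submonoid_gen ?B'" if "x + y = n * int d" for x y
    proof -
      \<comment> \<open>The sum \<open>n * d\<close> exceeds the sum of the Frobenius numbers, so
        both coordinates cannot stay below or at theirs; this supplies \<open>cover\<close>.\<close>
      have "x > frobenius_number ?B \<or> y > frobenius_number ?B'" using that Fn by linarith
      then show ?thesis
        using mem_submonoid_gen_if_gt_frobenius_number[OF Bd d gcd]
          mem_submonoid_gen_if_gt_frobenius_number[OF B'd d gcd'] by blast
    qed
    then show False
      using local_cohomology_trivial[of E \<epsilon> \<delta> n] n assms(7,8) by blast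
  qed
  then show ?thesis
    unfolding a_invariant_def by (intro SUP_least) simp
qed

end
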